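(* For every $S\in A_0$, the map $\beta^S:(0,\infty)\to C^*_u(\mathbb Z)$, $t\mapsto\beta_t(S)=U_t^*SU_t$, is continuous with respect to the operator norm.
   Context: Let $\varphi_0(x)=\max(1-|x|,0)$ for $x\in\mathbb R$, $\varphi_n(x)=\varphi_0(x-n)$ for $n\in\mathbb Z$, and for $t>0$ let $\varphi_n^t(x)=t^{-1/2}\varphi_n(x/t)$. Let $G\in\mathbb B(\ell^2(\mathbb Z))$ be the operator whose matrix in the standard basis $\{\delta_n\}$ is the Gram matrix $G_{nm}=\langle\varphi_n^t,\varphi_m^t\rangle$ (independent of $t$; positive and invertible), let $C=G^{-1/2}$ with matrix entries $C_{nm}$, and set $\psi_n^t=\sum_{m}C_{mn}\varphi_m^t$; these form an orthonormal system. Let $U_t:\ell^2(\mathbb Z)\to L^2(\mathbb R)$ be the isometry with $U_t\delta_n=\psi_n^t$, and $\beta_t(S)=U_t^*SU_t$ (matrix entries $\langle\psi_n^t,S\psi_m^t\rangle$). For $f\in L^\infty(\mathbb R)$ vanishing outside a bounded set and $g\in C_c(\mathbb R)$, let $(S_{f,g}u)(x)=\int f(x)g(y)u(x-y)\,dy$ on $L^2(\mathbb R)$; $A_0=L^\infty_0(\mathbb R)\rtimes\mathbb R$ is realized as the norm closure in $\mathbb B(L^2(\mathbb R))$ of the linear span of the operators $S_{f,g}$. $C^*_u(\mathbb Z)$ is the uniform Roe algebra of $\mathbb Z$ (norm closure of band matrices in $\mathbb B(\ell^2(\mathbb Z))$); $\beta_t(S)\in C^*_u(\mathbb Z)$ for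 such $S$. *)

theory Defs
  imports "HOL-Analysis.Analysis"
begin

definition phi0 :: "real \<Rightarrow> real" where
  "phi0 x = max (1 - \<bar>x\<bar>) 0"

definition phi :: "int \<Rightarrow> real \<Rightarrow> real" where
  "phi n x = phi0 (x - of_int n)"

definition phit :: "real \<Rightarrow> int \<Rightarrow> real \<Rightarrow> real" where
  "phit t n x = t powr (-1/2) * phi n (x / t)"

text \<open>Gram matrix G_nm = <phi_n^t, phi_m^t> (independent of t; we take t = 1).\<close>
definition gram :: "int \<Rightarrow> int \<Rightarrow> complex" where
  "gram n m = complex_of_real (LINT x|lborel. phi n x * phi m x)"

definition mform :: "(int \<Rightarrow> int \<Rightarrow> complex) \<Rightarrow> int set \<Rightarrow> (int \<Rightarrow> complex) \<Rightarrow> (int \<Rightarrow> complex) \<Rightarrow> complex" where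
  "mform M F x y = (\<Sum>n\<in>F. \<Sum>m\<in>F. cnj (y n) * M n m * x m)"

definition mnorm_le :: "(int \<Rightarrow> int \<Rightarrow> complex) \<Rightarrow> real \<Rightarrow> bool" where
  "mnorm_le M c \<longleftrightarrow> (\<forall>F x y. finite F \<longrightarrow> (\<Sum>m\<in>F. (cmod (x m))\<^sup>2) \<le> 1
      \<longrightarrow> (\<Sum>n\<in>F. (cmod (y n))\<^sup>2) \<le> 1 \<longrightarrow> cmod (mform M F x y) \<le> c)"

definition bounded_matrix :: "(int \<Rightarrow> int \<Rightarrow> complex) \<Rightarrow> bool" where
  "bounded_matrix M \<longleftrightarrow> (\<exists>K. mnorm_le M K)"

definition matprod :: "(int \<Rightarrow> int \<Rightarrow> complex) \<Rightarrow> (int \<Rightarrow> int \<Rightarrow> complex) \<Rightarrow> int \<Rightarrow> int \<Rightarrow> complex" where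
  "matprod A B n m = infsum (\<lambda>k. A n k * B k m) UNIV"

text \<open>C = G^(-1/2): the unique bounded positive (self-adjoint) operator with C C G = I.\<close>
definition Cmat :: "int \<Rightarrow> int \<Rightarrow> complex" where
  "Cmat = (THE C. bounded_matrix C
      \<and> (\<forall>n m. C n m = cnj (C m n))
      \<and> (\<forall>F x. finite F \<longrightarrow> 0 \<le> Re (mform C F x x))
      \<and> (\<forall>n m. matprod (matprod C C) gram n m = (if n = m then 1 else 0)))"

definition psi :: "real \<Rightarrow> int \<Rightarrow> real \<Rightarrow> complex" where
  "psi t n x = infsum (\<lambda>m. Cmat m n * complex_of_real (phit t m x)) UNIV"

definition sqint :: "(real \<Rightarrow> complex) \<Rightarrow> bool" where
  "sqint u \<longleftrightarrow> u \<in> borel_measurable lborel \<and> integrable lborel (\<lambda>x. (cmod (u x))\<^sup>2)"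

definition l2sq :: "(real \<Rightarrow> complex) \<Rightarrow> ennreal" where
  "l2sq u = (\<integral>\<^sup>+ x. ennreal ((cmod (u x))\<^sup>2) \<partial>lborel)"

definition Linf0 :: "(real \<Rightarrow> complex) \<Rightarrow> bool" where
  "Linf0 f \<longleftrightarrow> f \<in> borel_measurable lborel \<and> (\<exists>K. AE x in lborel. cmod (f x) \<le> K)
      \<and> (\<exists>B. bounded B \<and> (\<forall>x. x \<notin> B \<longrightarrow> f x = 0))"

definition Cc :: "(real \<Rightarrow> complex) \<Rightarrow> bool" where
  "Cc g \<longleftrightarrow> continuous_on UNIV g \<and> (\<exists>B. compact B \<and> (\<forall>x. x \<notin> B \<longrightarrow> g x = 0))"

definition Sfg :: "(real \<Rightarrow> complex) \<Rightarrow> (real \<Rightarrow> complex) \<Rightarrow> (real \<Rightarrow> complex) \<Rightarrow> real \<Rightarrow> complex" where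
  "Sfg f g u x = f x * (LINT y|lborel. g y * u (x - y))"

text \<open>S (acting on square integrable functions) lies in the operator-norm closure of the
  linear span of the S_{f,g}; scalars are absorbed into f.\<close>
definition inA0 :: "((real \<Rightarrow> complex) \<Rightarrow> (real \<Rightarrow> complex)) \<Rightarrow> bool" where
  "inA0 S \<longleftrightarrow> (\<forall>u. sqint u \<longrightarrow> S u \<in> borel_measurable lborel)
     \<and> (\<forall>\<epsilon>>0. \<exists>k fs gs. (\<forall>i<k. Linf0 (fs i) \<and> Cc (gs i))
          \<and> (\<forall>u. sqint u \<longrightarrow>
               l2sq (\<lambda>x. S u x - (\<Sum>i<(k::nat). Sfg (fs i) (gs i) u x)) \<le> ennreal (\<epsilon>\<^sup>2) * l2sq u))"

text \<open>Matrix entries of beta_t(S) = U_t^* S U_t.\<close>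
definition beta :: "real \<Rightarrow> ((real \<Rightarrow> complex) \<Rightarrow> (real \<Rightarrow> complex)) \<Rightarrow> int \<Rightarrow> int \<Rightarrow> complex" where
  "beta t S n m = (LINT x|lborel. cnj (psi t n x) * S (psi t m) x)"

end

theory Submission
  imports Defs
begin

text \<open>
  The operators \<open>S\<^sub>f\<^sub>,\<^sub>g\<close> only see functions on a fixed compact set. There the functions
  \<open>U\<^sub>t x = \<Sum> (C x)\<^sub>m \<phi>\<^sub>m\<^sup>t\<close> are piecewise linear with nodal values bounded by
  \<open>\<parallel>C\<parallel> \<parallel>x\<parallel>\<close>, hence Lipschitz with a constant independent of \<open>x\<close>, so \<open>U\<^sub>s x - U\<^sub>t x\<close> is
  uniformly small there as \<open>s\<close> tends to \<open>t\<close>. This gives norm continuity for \<open>S\<^sub>f\<^sub>,\<^sub>g\<close>, and uniform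
  boundedness of \<open>U\<^sub>t\<close> passes it to the closure \<open>A\<^sub>0\<close>.

  The only input about \<open>C = G\<^sup>-\<^sup>1\<^sup>/\<^sup>2\<close> is its boundedness, but since \<^const>\<open>Cmat\<close> is a definite
  description, this requires existence and uniqueness of the positive inverse square root. Here
  \<open>G = 2/3 (1 + T)\<close> with \<open>\<parallel>T\<parallel> \<le> 1/2\<close>, so the binomial series for \<open>(1 + T)\<^sup>-\<^sup>1\<^sup>/\<^sup>2\<close> converges in the Banach
  algebra of bounded matrices to a self-adjoint \<open>A\<close> bounded below. If \<open>D\<close> is another candidate, it
  commutes with \<open>G\<close>, hence with \<open>A\<close>, and \<open>(A + D) (A - D) = A\<^sup>2 - D\<^sup>2 = 0\<close> with \<open>A + D\<close> bounded below.
\<close>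

section \<open>Bounded matrices acting on square summable sequences\<close>

text \<open>\<open>B\<close> bounds the squared norm. The condition is stated through finite sums so
  that estimates for finite sections yield it directly, with no separate summability claim.\<close>

definition l2_le :: "(int \<Rightarrow> complex) \<Rightarrow> real \<Rightarrow> bool" where
  "l2_le x B \<longleftrightarrow> (\<forall>F. finite F \<longrightarrow> (\<Sum>n\<in>F. (cmod (x n))\<^sup>2) \<le> B)"

definition matvec :: "(int \<Rightarrow> int \<Rightarrow> complex) \<Rightarrow> (int \<Rightarrow> complex) \<Rightarrow> int \<Rightarrow> complex" where
  "matvec M x n = infsum (\<lambda>m. M n m * x m) UNIV"

lemma mnorm_le_nonneg: "mnorm_le M K \<Longrightarrow> 0 \<le> K"
  unfolding mnorm_le_def by (drule spec[where x="{}"]) (auto simp: mform_def)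

text \<open>By homogeneity: divide both vectors by their norms on \<open>F\<close>. If one norm is
  zero, that vector vanishes on \<open>F\<close> and so does the form.\<close>

lemma mform_bound:
  assumes M: "mnorm_le M K" and F: "finite F"
  shows "cmod (mform M F x y) \<le> K * L2_set (\<lambda>m. cmod (x m)) F * L2_set (\<lambda>n. cmod (y n)) F"
proof -
  let ?a = "L2_set (\<lambda>m. cmod (x m)) F" and ?b = "L2_set (\<lambda>n. cmod (y n)) F"
  show ?thesis
  proof (cases "?a = 0 \<or> ?b = 0")
    case True
    then have "mform M F x y = 0"
      using F by (auto simp: mform_def L2_set_eq_0_iff intro!: sum.neutral)
    then show ?thesis using mnorm_le_nonneg[OF M] by simp
  next
    case False
    then have a: "?a > 0" and b: "?b > 0" using L2_set_nonneg by (metis less_eq_real_def)+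
    have sq: "(\<Sum>m\<in>F. (cmod (x m / of_real (L2_set (\<lambda>m. cmod (x m)) F)))\<^sup>2) \<le> 1"
      if "L2_set (\<lambda>m. cmod (x m)) F > 0" for x :: "int \<Rightarrow> complex"
    proof -
      have "(\<Sum>m\<in>F. (cmod (x m / of_real (L2_set (\<lambda>m. cmod (x m)) F)))\<^sup>2)
          = (\<Sum>m\<in>F. (cmod (x m))\<^sup>2) / (L2_set (\<lambda>m. cmod (x m)) F)\<^sup>2"
        using that by (simp add: norm_divide power_divide sum_divide_distrib)
      also have "(L2_set (\<lambda>m. cmod (x m)) F)\<^sup>2 = (\<Sum>m\<in>F. (cmod (x m))\<^sup>2)"
        by (simp add: L2_set_def sum_nonneg)
      finally show ?thesis by (simp add: divide_le_eq_1)
    qed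
    have "cmod (mform M F (\<lambda>m. x m / of_real ?a) (\<lambda>m. y m / of_real ?b)) \<le> K"
      by (rule M[unfolded mnorm_le_def, rule_format, OF F sq[OF a] sq[OF b]])
    also have "mform M F (\<lambda>m. x m / of_real ?a) (\<lambda>m. y m / of_real ?b) = mform M F x y / of_real (?a * ?b)"
      by (simp add: mform_def sum_divide_distrib mult_ac)
    finally have "cmod (mform M F x y) / (?a * ?b) \<le> K"
      by (simp only: norm_divide norm_of_real abs_mult abs_of_pos[OF a] abs_of_pos[OF b])
    then show ?thesis using a b by (simp add: divide_le_eq mult_ac)
  qed
qed

text \<open>Extending both vectors by zero to \<open>F \<union> F'\<close> turns the rectangular sum
  into a square section.\<close>

lemma mform_rect_bound:
  assumes M: "mnorm_le M K" and F: "finite F" "finite F'"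
  shows "cmod (\<Sum>n\<in>F'. \<Sum>m\<in>F. cnj (y n) * M n m * x m)
     \<le> K * L2_set (\<lambda>m. cmod (x m)) F * L2_set (\<lambda>n. cmod (y n)) F'"
proof -
  define x' where "x' m = (if m \<in> F then x m else 0)" for m
  define y' where "y' m = (if m \<in> F' then y m else 0)" for m
  have "mform M (F \<union> F') x' y' = (\<Sum>n\<in>F'. \<Sum>m\<in>F. cnj (y n) * M n m * x m)"
    unfolding mform_def
  proof (rule sum.mono_neutral_cong_right)
    fix n assume n: "n \<in> F'"
    show "(\<Sum>m\<in>F \<union> F'. cnj (y' n) * M n m * x' m) = (\<Sum>m\<in>F. cnj (y n) * M n m * x m)"
      by (rule sum.mono_neutral_cong_right) (use F n in \<open>auto simp: x'_def y'_def\<close>)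
  qed (use F in \<open>auto simp: y'_def\<close>)
  moreover have "L2_set (\<lambda>m. cmod (x' m)) (F \<union> F') = L2_set (\<lambda>m. cmod (x m)) F"
    unfolding L2_set_def
    by (rule arg_cong[where f=sqrt], rule sum.mono_neutral_cong_right) (use F in \<open>auto simp: x'_def\<close>)
  moreover have "L2_set (\<lambda>m. cmod (y' m)) (F \<union> F') = L2_set (\<lambda>m. cmod (y m)) F'"
    unfolding L2_set_def
    by (rule arg_cong[where f=sqrt], rule sum.mono_neutral_cong_right) (use F in \<open>auto simp: y'_def\<close>)
  ultimately show ?thesis
    using mform_bound[OF M, of "F \<union> F'" x' y'] F by simp
qed

text \<open>Test the form against the image itself: with \<open>y = M x\<close> it equals the
  squared norm of \<open>y\<close> on \<open>F'\<close>, so that norm cancels once from both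
  sides.\<close>

lemma section_bound:
  assumes M: "mnorm_le M K" and F: "finite F" "finite F'"
  shows "(\<Sum>n\<in>F'. (cmod (\<Sum>m\<in>F. M n m * x m))\<^sup>2) \<le> K\<^sup>2 * (\<Sum>m\<in>F. (cmod (x m))\<^sup>2)"
proof -
  define y where "y n = (\<Sum>m\<in>F. M n m * x m)" for n
  let ?s = "\<Sum>n\<in>F'. (cmod (y n))\<^sup>2"
  have s0: "?s \<ge> 0" by (simp add: sum_nonneg)
  have "(\<Sum>n\<in>F'. \<Sum>m\<in>F. cnj (y n) * M n m * x m) = of_real ?s"
    unfolding of_real_sum
  proof (intro sum.cong refl)
    fix n
    have "(\<Sum>m\<in>F. cnj (y n) * M n m * x m) = cnj (y n) * y n"
      by (simp add: y_def sum_distrib_left mult.assoc)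
    then show "(\<Sum>m\<in>F. cnj (y n) * M n m * x m) = complex_of_real ((cmod (y n))\<^sup>2)"
      by (simp only: complex_norm_square mult.commute)
  qed
  then have "?s \<le> K * sqrt (\<Sum>m\<in>F. (cmod (x m))\<^sup>2) * sqrt ?s"
    using mform_rect_bound[OF M F, of y x] s0 by (simp add: L2_set_def del: of_real_sum)
  then have "sqrt ?s * sqrt ?s \<le> (K * sqrt (\<Sum>m\<in>F. (cmod (x m))\<^sup>2)) * sqrt ?s"
    using s0 by simp
  then have "sqrt ?s \<le> K * sqrt (\<Sum>m\<in>F. (cmod (x m))\<^sup>2)"
    using s0 mnorm_le_nonneg[OF M]
    by (cases "sqrt ?s = 0")
       (simp add: sum_nonneg, metis mult_right_le_imp_le order_le_less real_sqrt_ge_zero)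
  then have "(sqrt ?s)\<^sup>2 \<le> (K * sqrt (\<Sum>m\<in>F. (cmod (x m))\<^sup>2))\<^sup>2"
    using s0 by (intro power_mono) auto
  then show ?thesis using s0 by (simp add: power_mult_distrib sum_nonneg y_def)
qed

lemma mnorm_le_transpose: "mnorm_le M K \<Longrightarrow> mnorm_le (\<lambda>n m. M m n) K"
proof -
  assume M: "mnorm_le M K"
  have eq: "mform (\<lambda>n m. M m n) F x y = mform M F (\<lambda>n. cnj (y n)) (\<lambda>n. cnj (x n))" for F x y
    unfolding mform_def by (subst sum.swap) (simp add: mult_ac)
  show ?thesis
    unfolding mnorm_le_def eq
  proof (intro allI impI)
    fix F and x y :: "int \<Rightarrow> complex"
    assume "finite F" "(\<Sum>m\<in>F. (cmod (x m))\<^sup>2) \<le> 1" "(\<Sum>n\<in>F. (cmod (y n))\<^sup>2) \<le> 1"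
    then show "cmod (mform M F (\<lambda>n. cnj (y n)) (\<lambda>n. cnj (x n))) \<le> K"
      using M[unfolded mnorm_le_def, rule_format, of F "\<lambda>n. cnj (y n)" "\<lambda>n. cnj (x n)"] by simp
  qed
qed

lemma column_l2_le: "mnorm_le M K \<Longrightarrow> l2_le (\<lambda>n. M n m) (K\<^sup>2)"
  unfolding l2_le_def using section_bound[of M K "{m}" _ "\<lambda>_. 1"] by simp

lemma row_l2_le: "mnorm_le M K \<Longrightarrow> l2_le (\<lambda>m. M n m) (K\<^sup>2)"
  using column_l2_le[OF mnorm_le_transpose] .

lemma finite_sum_of_summables:
  fixes f :: "'i \<Rightarrow> 'b \<Rightarrow> complex"
  assumes "finite I" "\<And>i. i \<in> I \<Longrightarrow> f i summable_on A"
  shows "(\<lambda>k. \<Sum>i\<in>I. f i k) summable_on A"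
    and infsum_finite_sum: "infsum (\<lambda>k. \<Sum>i\<in>I. f i k) A = (\<Sum>i\<in>I. infsum (f i) A)"
proof -
  have "(\<lambda>k. \<Sum>i\<in>I. f i k) summable_on A \<and> infsum (\<lambda>k. \<Sum>i\<in>I. f i k) A = (\<Sum>i\<in>I. infsum (f i) A)"
    using assms by (induction I) (auto intro: summable_on_add simp: infsum_add)
  then show "(\<lambda>k. \<Sum>i\<in>I. f i k) summable_on A"
    "infsum (\<lambda>k. \<Sum>i\<in>I. f i k) A = (\<Sum>i\<in>I. infsum (f i) A)" by auto
qed

section \<open>Square summable sequences and their products\<close>

lemma l2_le_nonneg: "l2_le x B \<Longrightarrow> 0 \<le> B"
  unfolding l2_le_def by (drule spec[where x="{}"]) auto

lemma l2_le_cnj [simp]: "l2_le (\<lambda>n. cnj (x n)) B \<longleftrightarrow> l2_le x B"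
  by (simp add: l2_le_def)

lemma l2_le_cmod: "l2_le x B \<Longrightarrow> cmod (x n) \<le> sqrt B"
  unfolding l2_le_def by (drule spec[where x="{n}"]) (auto intro: real_le_rsqrt)

lemma l2_summable: "l2_le x B \<Longrightarrow> (\<lambda>n. (cmod (x n))\<^sup>2) summable_on A"
  by (rule nonneg_bdd_above_summable_on) (auto simp: l2_le_def bdd_above_def)

lemma l2_prod_sum_le:
  assumes "l2_le x A" "l2_le y B" "finite F"
  shows "(\<Sum>n\<in>F. cmod (x n * y n)) \<le> sqrt A * sqrt B"
proof -
  have "(\<Sum>n\<in>F. cmod (x n * y n)) \<le> L2_set (\<lambda>n. cmod (x n)) F * L2_set (\<lambda>n. cmod (y n)) F"
    using L2_set_mult_ineq[of "\<lambda>n. cmod (x n)" "\<lambda>n. cmod (y n)" F] by (simp add: norm_mult)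
  also have "\<dots> \<le> sqrt A * sqrt B"
    using assms l2_le_nonneg by (intro mult_mono) (auto simp: L2_set_def l2_le_def sum_nonneg)
  finally show ?thesis .
qed

lemma l2_prod_abs_summable:
  assumes "l2_le x A" "l2_le y B"
  shows "(\<lambda>n. cmod (x n * y n)) summable_on S"
  by (rule nonneg_bdd_above_summable_on)
     (use l2_prod_sum_le[OF assms] in \<open>auto simp: bdd_above_def\<close>)

lemma l2_prod_summable:
  assumes "l2_le x A" "l2_le y B"
  shows "(\<lambda>n. x n * y n) summable_on S"
  by (rule abs_summable_summable, rule l2_prod_abs_summable[OF assms])

section \<open>Bounded matrices acting on infinite sequences\<close>

lemma matvec_summable: "mnorm_le M K \<Longrightarrow> l2_le x B \<Longrightarrow> (\<lambda>m. M n m * x m) summable_on S"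
  by (rule l2_prod_summable[OF row_l2_le])

text \<open>For a fixed finite set of rows the bound holds for every finite set of columns, by
  \<open>section_bound\<close>, and survives the limit over column sets.\<close>

lemma matvec_l2_le:
  assumes M: "mnorm_le M K" and x: "l2_le x B"
  shows "l2_le (matvec M x) (K\<^sup>2 * B)"
  unfolding l2_le_def
proof (intro allI impI)
  fix F' :: "int set" assume F': "finite F'"
  have "((\<lambda>F. \<Sum>n\<in>F'. (cmod (\<Sum>m\<in>F. M n m * x m))\<^sup>2) \<longlongrightarrow> (\<Sum>n\<in>F'. (cmod (matvec M x n))\<^sup>2))
     (finite_subsets_at_top UNIV)"
    unfolding matvec_def by (intro tendsto_intros infsum_tendsto matvec_summable[OF M x])
  moreover have "\<forall>\<^sub>F F in finite_subsets_at_top UNIV.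
      (\<Sum>n\<in>F'. (cmod (\<Sum>m\<in>F. M n m * x m))\<^sup>2) \<le> K\<^sup>2 * B"
  proof (rule eventually_finite_subsets_at_top_weakI)
    fix F :: "int set" assume F: "finite F"
    show "(\<Sum>n\<in>F'. (cmod (\<Sum>m\<in>F. M n m * x m))\<^sup>2) \<le> K\<^sup>2 * B"
      using section_bound[OF M F F', of x] x F unfolding l2_le_def
      by (elim allE[where x=F] impE) (auto intro: order_trans[OF _ mult_left_mono])
  qed
  ultimately show "(\<Sum>n\<in>F'. (cmod (matvec M x n))\<^sup>2) \<le> K\<^sup>2 * B"
    by (rule tendsto_upperbound) simp
qed

text \<open>Replacing \<open>x\<close> by its restriction to \<open>F\<close> costs \<open>M\<close>
  applied to the tail of \<open>x\<close>. The norm of the tail tends to zero, and the pairing with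
  \<open>y\<close> is controlled by Cauchy-Schwarz uniformly in \<open>F\<close>.\<close>

lemma mform_tendsto:
  assumes M: "mnorm_le M K" and x: "l2_le x A" and y: "l2_le y B"
  shows "((\<lambda>F. mform M F x y) \<longlongrightarrow> (\<Sum>\<^sub>\<infinity>n. cnj (y n) * matvec M x n)) (finite_subsets_at_top UNIV)"
proof -
  let ?T = "finite_subsets_at_top (UNIV :: int set)"
  \<comment> \<open>\<open>r F\<close> is the squared norm of the part of \<open>x\<close> outside
    \<open>F\<close>.\<close>
  define r where "r F = (\<Sum>\<^sub>\<infinity>m. (cmod (x m))\<^sup>2) - (\<Sum>m\<in>F. (cmod (x m))\<^sup>2)" for F
  have tail: "l2_le (\<lambda>m. if m \<in> F then 0 else x m) (r F)" if F: "finite F" for F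
    unfolding l2_le_def
  proof (intro allI impI)
    fix H :: "int set" assume H: "finite H"
    have "(\<Sum>n\<in>H. (cmod (if n \<in> F then 0 else x n))\<^sup>2) + (\<Sum>n\<in>F. (cmod (x n))\<^sup>2)
       = (\<Sum>n\<in>H - F. (cmod (x n))\<^sup>2) + (\<Sum>n\<in>F. (cmod (x n))\<^sup>2)"
      using H by (auto intro!: sum.mono_neutral_cong_right)
    also have "\<dots> = (\<Sum>n\<in>(H - F) \<union> F. (cmod (x n))\<^sup>2)"
      by (rule sum.union_disjoint[symmetric]) (use F H in auto)
    also have "\<dots> \<le> (\<Sum>\<^sub>\<infinity>m. (cmod (x m))\<^sup>2)"
      by (rule finite_sum_le_infsum) (use F H l2_summable[OF x] in auto)
    finally show "(\<Sum>n\<in>H. (cmod (if n \<in> F then 0 else x n))\<^sup>2) \<le> r F"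
      by (simp add: r_def)
  qed
  have r0: "(r \<longlongrightarrow> 0) ?T"
    using tendsto_diff[OF tendsto_const infsum_tendsto[OF l2_summable[OF x]],
        of "\<Sum>\<^sub>\<infinity>m. (cmod (x m))\<^sup>2" UNIV]
    unfolding r_def by simp
  have split: "matvec M x n - (\<Sum>m\<in>F. M n m * x m) = matvec M (\<lambda>m. if m \<in> F then 0 else x m) n"
    if F: "finite F" for F n
  proof -
    have "matvec M x n = (\<Sum>\<^sub>\<infinity>m. M n m * (if m \<in> F then x m else 0) + M n m * (if m \<in> F then 0 else x m))"
      unfolding matvec_def by (rule infsum_cong) auto
    also have "\<dots> = (\<Sum>\<^sub>\<infinity>m. M n m * (if m \<in> F then x m else 0)) + (\<Sum>\<^sub>\<infinity>m. M n m * (if m \<in> F then 0 else x m))"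
      by (intro infsum_add matvec_summable[OF M tail[OF F]] finite_nonzero_values_imp_summable_on)
         (rule finite_subset[OF _ F], auto)
    also have "(\<Sum>\<^sub>\<infinity>m. M n m * (if m \<in> F then x m else 0)) = (\<Sum>\<^sub>\<infinity>m\<in>F. M n m * x m)"
      by (rule infsum_cong_neutral) auto
    finally show ?thesis using F by (simp add: matvec_def)
  qed
  have bnd: "cmod ((\<Sum>n\<in>F. cnj (y n) * matvec M x n) - mform M F x y) \<le> sqrt B * sqrt (K\<^sup>2 * r F)"
    if F: "finite F" for F
  proof -
    have "(\<Sum>n\<in>F. cnj (y n) * matvec M x n) - mform M F x y
       = (\<Sum>n\<in>F. cnj (y n) * matvec M (\<lambda>m. if m \<in> F then 0 else x m) n)"
      unfolding split[OF F, symmetric] mform_def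
      by (simp add: right_diff_distrib sum_subtractf sum_distrib_left mult_ac)
    also have "cmod \<dots> \<le> (\<Sum>n\<in>F. cmod (cnj (y n) * matvec M (\<lambda>m. if m \<in> F then 0 else x m) n))"
      by (rule norm_sum)
    also have "\<dots> \<le> sqrt B * sqrt (K\<^sup>2 * r F)"
      by (rule l2_prod_sum_le[OF _ matvec_l2_le[OF M tail[OF F]] F]) (simp add: y)
    finally show ?thesis .
  qed
  have "((\<lambda>F. sqrt B * sqrt (K\<^sup>2 * r F)) \<longlongrightarrow> sqrt B * sqrt (K\<^sup>2 * 0)) ?T"
    by (intro tendsto_intros r0)
  then have "((\<lambda>F. (\<Sum>n\<in>F. cnj (y n) * matvec M x n) - mform M F x y) \<longlongrightarrow> 0) ?T"
    by (intro Lim_null_comparison[OF eventually_finite_subsets_at_top_weakI[OF bnd]]) auto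
  moreover have "((\<lambda>F. \<Sum>n\<in>F. cnj (y n) * matvec M x n) \<longlongrightarrow> (\<Sum>\<^sub>\<infinity>n. cnj (y n) * matvec M x n)) ?T"
    by (intro infsum_tendsto l2_prod_summable[OF y[folded l2_le_cnj[of y]] matvec_l2_le[OF M x]])
  ultimately show ?thesis
    using tendsto_diff[of "\<lambda>F. \<Sum>n\<in>F. cnj (y n) * matvec M x n" _ ?T] by fastforce
qed

text \<open>The double series need not converge absolutely; both iterated sums are limits of the
  finite sections of the bounded form.\<close>

lemma bounded_iterated_sum_swap:
  assumes M: "mnorm_le M K" and x: "l2_le x A" and y: "l2_le y B"
  shows "(\<Sum>\<^sub>\<infinity>n. y n * (\<Sum>\<^sub>\<infinity>m. M n m * x m)) = (\<Sum>\<^sub>\<infinity>m. (\<Sum>\<^sub>\<infinity>n. y n * M n m) * x m)"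
proof -
  have eq: "mform (\<lambda>n m. M m n) F y (\<lambda>n. cnj (x n)) = mform M F x (\<lambda>n. cnj (y n))" for F
    unfolding mform_def by (subst sum.swap) (simp add: mult_ac)
  have "((\<lambda>F. mform M F x (\<lambda>n. cnj (y n))) \<longlongrightarrow> (\<Sum>\<^sub>\<infinity>n. y n * matvec M x n)) (finite_subsets_at_top UNIV)"
    using mform_tendsto[OF M x, of "\<lambda>n. cnj (y n)" B] y by simp
  moreover have "((\<lambda>F. mform M F x (\<lambda>n. cnj (y n))) \<longlongrightarrow> (\<Sum>\<^sub>\<infinity>n. x n * matvec (\<lambda>n m. M m n) y n))
     (finite_subsets_at_top UNIV)"
    using mform_tendsto[OF mnorm_le_transpose[OF M] y, of "\<lambda>n. cnj (x n)" A] x eq by simp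
  ultimately have "(\<Sum>\<^sub>\<infinity>n. y n * matvec M x n) = (\<Sum>\<^sub>\<infinity>n. x n * matvec (\<lambda>n m. M m n) y n)"
    by (rule tendsto_unique[rotated]) simp
  then show ?thesis by (simp add: matvec_def mult.commute)
qed

section \<open>Algebra and norm estimates for bounded matrices\<close>

text \<open>Each entry pairs a row of \<open>A\<close> with a column of \<open>C\<close> through
  \<open>B\<close>. Row and column are square summable, so \<open>bounded_iterated_sum_swap\<close>
  applies.\<close>

lemma matprod_assoc:
  assumes "mnorm_le A a" "mnorm_le B b" "mnorm_le C c"
  shows "matprod (matprod A B) C = matprod A (matprod B C)"
  using bounded_iterated_sum_swap[OF assms(2) column_l2_le[OF assms(3)] row_l2_le[OF assms(1)]]
  by (intro ext) (simp add: matprod_def)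

text \<open>The finite sums move inside the sum over \<open>k\<close>, leaving the pairing of
  \<open>u\<close>, the transpose of \<open>A\<close> applied to the conjugate of \<open>y\<close>,
  with \<open>v = B x\<close>. Section bounds and Cauchy-Schwarz finish.\<close>

lemma mnorm_le_matprod:
  assumes A: "mnorm_le A a" and B: "mnorm_le B b"
  shows "mnorm_le (matprod A B) (a * b)"
  unfolding mnorm_le_def
proof (intro allI impI)
  fix F :: "int set" and x y :: "int \<Rightarrow> complex"
  assume F: "finite F" and x: "(\<Sum>m\<in>F. (cmod (x m))\<^sup>2) \<le> 1" and y: "(\<Sum>n\<in>F. (cmod (y n))\<^sup>2) \<le> 1"
  define u where "u k = (\<Sum>n\<in>F. cnj (y n) * A n k)" for k
  define v where "v k = (\<Sum>m\<in>F. B k m * x m)" for k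
  have u: "l2_le u (a\<^sup>2)" unfolding l2_le_def
  proof (intro allI impI)
    fix H :: "int set" assume "finite H"
    from section_bound[OF mnorm_le_transpose[OF A] F this, of "\<lambda>n. cnj (y n)"] y
    show "(\<Sum>n\<in>H. (cmod (u n))\<^sup>2) \<le> a\<^sup>2"
      using mult_left_le[of "\<Sum>n\<in>F. (cmod (y n))\<^sup>2" "a\<^sup>2"] by (simp add: u_def mult.commute)
  qed
  have v: "l2_le v (b\<^sup>2)" unfolding l2_le_def
  proof (intro allI impI)
    fix H :: "int set" assume "finite H"
    from section_bound[OF B F this, of x] x
    show "(\<Sum>n\<in>H. (cmod (v n))\<^sup>2) \<le> b\<^sup>2"
      using mult_left_le[of "\<Sum>n\<in>F. (cmod (x n))\<^sup>2" "b\<^sup>2"] by (simp add: v_def)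
  qed
  have s: "(\<lambda>k. cnj (y n) * (A n k * B k m) * x m) summable_on UNIV" for n m
    by (intro summable_on_cmult_left summable_on_cmult_right l2_prod_summable[OF row_l2_le[OF A] column_l2_le[OF B]])
  have "mform (matprod A B) F x y = (\<Sum>n\<in>F. \<Sum>m\<in>F. \<Sum>\<^sub>\<infinity>k. cnj (y n) * (A n k * B k m) * x m)"
    by (simp add: mform_def matprod_def infsum_cmult_left' infsum_cmult_right')
  also have "\<dots> = (\<Sum>n\<in>F. \<Sum>\<^sub>\<infinity>k. \<Sum>m\<in>F. cnj (y n) * (A n k * B k m) * x m)"
    by (intro sum.cong refl infsum_finite_sum[symmetric] F s)
  also have "\<dots> = (\<Sum>\<^sub>\<infinity>k. \<Sum>n\<in>F. \<Sum>m\<in>F. cnj (y n) * (A n k * B k m) * x m)"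
    by (intro infsum_finite_sum[symmetric] finite_sum_of_summables F s)
  also have "\<dots> = (\<Sum>\<^sub>\<infinity>k. u k * v k)"
    unfolding u_def v_def sum_product by (simp only: mult.assoc)
  also have "cmod \<dots> \<le> (\<Sum>\<^sub>\<infinity>k. cmod (u k * v k))"
    by (rule norm_infsum_bound[OF l2_prod_abs_summable[OF u v]])
  also have "\<dots> \<le> sqrt (a\<^sup>2) * sqrt (b\<^sup>2)"
    by (intro infsum_le_finite_sums l2_prod_abs_summable[OF u v] l2_prod_sum_le[OF u v])
  also have "\<dots> = a * b" using mnorm_le_nonneg[OF A] mnorm_le_nonneg[OF B] by simp
  finally show "cmod (mform (matprod A B) F x y) \<le> a * b" .
qed

lemma mform_add: "mform (\<lambda>n m. A n m + B n m) F x y = mform A F x y + mform B F x y"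
  by (simp add: mform_def algebra_simps sum.distrib)

lemma mform_diff: "mform (\<lambda>n m. A n m - B n m) F x y = mform A F x y - mform B F x y"
  by (simp add: mform_def algebra_simps sum_subtractf)

lemma mform_cmult: "mform (\<lambda>n m. c * A n m) F x y = c * mform A F x y"
  by (simp add: mform_def sum_distrib_left mult_ac)

lemma mnorm_le_add:
  assumes A: "mnorm_le A a" and B: "mnorm_le B b"
  shows "mnorm_le (\<lambda>n m. A n m + B n m) (a + b)"
  unfolding mnorm_le_def mform_add
proof (intro allI impI)
  fix F and x y :: "int \<Rightarrow> complex"
  assume F: "finite F" "(\<Sum>m\<in>F. (cmod (x m))\<^sup>2) \<le> 1" "(\<Sum>n\<in>F. (cmod (y n))\<^sup>2) \<le> 1"
  show "cmod (mform A F x y + mform B F x y) \<le> a + b"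
    using A[unfolded mnorm_le_def, rule_format, OF F] B[unfolded mnorm_le_def, rule_format, OF F]
    by (rule norm_triangle_mono)
qed

lemma mnorm_le_cmult:
  assumes A: "mnorm_le A a"
  shows "mnorm_le (\<lambda>n m. c * A n m) (cmod c * a)"
  unfolding mnorm_le_def mform_cmult norm_mult
proof (intro allI impI)
  fix F and x y :: "int \<Rightarrow> complex"
  assume F: "finite F" "(\<Sum>m\<in>F. (cmod (x m))\<^sup>2) \<le> 1" "(\<Sum>n\<in>F. (cmod (y n))\<^sup>2) \<le> 1"
  show "cmod c * cmod (mform A F x y) \<le> cmod c * a"
    using A[unfolded mnorm_le_def, rule_format, OF F] by (rule mult_left_mono) simp
qed

lemma mnorm_le_uminus: "mnorm_le A a \<Longrightarrow> mnorm_le (\<lambda>n m. - A n m) a"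
  using mnorm_le_cmult[of A a "-1"] by simp

lemma mnorm_le_cnj_transpose:
  assumes A: "mnorm_le A a"
  shows "mnorm_le (\<lambda>n m. cnj (A m n)) a"
proof -
  have eq: "mform (\<lambda>n m. cnj (A m n)) F x y = cnj (mform A F y x)" for F x y
    unfolding mform_def by (subst sum.swap) (simp add: mult_ac)
  show ?thesis
    unfolding mnorm_le_def eq complex_mod_cnj
    using A[unfolded mnorm_le_def, rule_format] by auto
qed

lemma mnorm_le_zero: "mnorm_le (\<lambda>n m. 0) 0"
  by (simp add: mnorm_le_def mform_def)

text \<open>Schur test. The arithmetic-geometric mean inequality splits each term into a part
  weighted by \<open>y n\<close>, summed along rows, and a part weighted by \<open>x m\<close>,
  summed along columns.\<close>

lemma mnorm_le_schur:
  assumes row: "\<And>n F. finite F \<Longrightarrow> (\<Sum>m\<in>F. cmod (A n m)) \<le> c"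
    and col: "\<And>m F. finite F \<Longrightarrow> (\<Sum>n\<in>F. cmod (A n m)) \<le> c"
  shows "mnorm_le A c"
  unfolding mnorm_le_def
proof (intro allI impI)
  fix F and x y :: "int \<Rightarrow> complex"
  assume F: "finite F" and x: "(\<Sum>m\<in>F. (cmod (x m))\<^sup>2) \<le> 1" and y: "(\<Sum>n\<in>F. (cmod (y n))\<^sup>2) \<le> 1"
  have c: "0 \<le> c" using row[of "{}"] by simp
  have "cmod (mform A F x y) \<le> (\<Sum>n\<in>F. \<Sum>m\<in>F. cmod (cnj (y n) * A n m * x m))"
    unfolding mform_def by (intro sum_norm_le order_refl)
  also have "\<dots> \<le> (\<Sum>n\<in>F. \<Sum>m\<in>F. (cmod (y n))\<^sup>2 / 2 * cmod (A n m) + (cmod (x m))\<^sup>2 / 2 * cmod (A n m))"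
  proof (intro sum_mono)
    fix n m
    have "cmod (y n) * cmod (x m) \<le> (cmod (y n))\<^sup>2 / 2 + (cmod (x m))\<^sup>2 / 2"
      using sum_squares_bound[of "cmod (y n)" "cmod (x m)"] by simp
    then have "cmod (A n m) * (cmod (y n) * cmod (x m)) \<le> cmod (A n m) * ((cmod (y n))\<^sup>2 / 2 + (cmod (x m))\<^sup>2 / 2)"
      by (rule mult_left_mono) simp
    then show "cmod (cnj (y n) * A n m * x m) \<le> (cmod (y n))\<^sup>2 / 2 * cmod (A n m) + (cmod (x m))\<^sup>2 / 2 * cmod (A n m)"
      by (simp add: norm_mult algebra_simps)
  qed
  also have "\<dots> = (\<Sum>n\<in>F. (cmod (y n))\<^sup>2 / 2 * (\<Sum>m\<in>F. cmod (A n m)))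
      + (\<Sum>m\<in>F. (cmod (x m))\<^sup>2 / 2 * (\<Sum>n\<in>F. cmod (A n m)))"
    unfolding sum.distrib sum_distrib_left
    by (subst (2) sum.swap) simp
  also have "\<dots> \<le> (\<Sum>n\<in>F. (cmod (y n))\<^sup>2 / 2 * c) + (\<Sum>m\<in>F. (cmod (x m))\<^sup>2 / 2 * c)"
    by (intro add_mono sum_mono mult_left_mono row col F) auto
  also have "\<dots> = ((\<Sum>n\<in>F. (cmod (y n))\<^sup>2) / 2 + (\<Sum>m\<in>F. (cmod (x m))\<^sup>2) / 2) * c"
    by (simp add: sum_divide_distrib sum_distrib_right distrib_right)
  also have "\<dots> \<le> 1 * c"
    using x y c by (intro mult_right_mono) auto
  finally show "cmod (mform A F x y) \<le> c" by simp
qed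

lemma mnorm_le_one: "mnorm_le (\<lambda>n m. if n = m then 1 else 0) 1"
proof (rule mnorm_le_schur)
  fix m :: int and F :: "int set" assume "finite F"
  then show "(\<Sum>n\<in>F. cmod (if n = m then 1 else 0)) \<le> 1"
    "(\<Sum>n\<in>F. cmod (if m = n then 1 else 0)) \<le> 1"
    by (simp_all add: if_distrib cong: if_cong)
qed

lemma mnorm_le_mono: "mnorm_le A a \<Longrightarrow> a \<le> b \<Longrightarrow> mnorm_le A b"
  unfolding mnorm_le_def by (meson order_trans)

lemma mnorm_le_entry: "mnorm_le A a \<Longrightarrow> cmod (A n m) \<le> a"
  using section_bound[of A a "{m}" "{n}" "\<lambda>_. 1"] mnorm_le_nonneg[of A a]
  by (simp add: abs_le_square_iff[symmetric])

section \<open>The Banach algebra of bounded matrices\<close>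

text \<open>A type of bounded matrices makes the general theory of series and Cauchy products in
  Banach algebras available for the power series below.\<close>

typedef bmat = "{M :: int \<Rightarrow> int \<Rightarrow> complex. bounded_matrix M}"
  morphisms entry Bmat
  using mnorm_le_zero by (auto simp: bounded_matrix_def)

setup_lifting type_definition_bmat

lemma bmat_eqI: "(\<And>n m. entry A n m = entry B n m) \<Longrightarrow> A = B"
  by (metis entry_inject ext)

lemma bounded_matrix_entry: "bounded_matrix (entry A)"
  using entry by auto

instantiation bmat :: real_normed_algebra_1
begin

definition norm_bmat :: "bmat \<Rightarrow> real" where
  "norm_bmat A = Inf {c. mnorm_le (entry A) c}"

lift_definition zero_bmat :: bmat is "\<lambda>n m. 0"
  using mnorm_le_zero unfolding bounded_matrix_def by blast

lift_definition one_bmat :: bmat is "\<lambda>n m. if n = m then 1 else 0"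
  using mnorm_le_one unfolding bounded_matrix_def by blast

lift_definition plus_bmat :: "bmat \<Rightarrow> bmat \<Rightarrow> bmat" is "\<lambda>A B n m. A n m + B n m"
  using mnorm_le_add unfolding bounded_matrix_def by blast

lift_definition uminus_bmat :: "bmat \<Rightarrow> bmat" is "\<lambda>A n m. - A n m"
  using mnorm_le_uminus unfolding bounded_matrix_def by blast

lift_definition minus_bmat :: "bmat \<Rightarrow> bmat \<Rightarrow> bmat" is "\<lambda>A B n m. A n m - B n m"
  using mnorm_le_add[OF _ mnorm_le_uminus] unfolding bounded_matrix_def by fastforce

lift_definition times_bmat :: "bmat \<Rightarrow> bmat \<Rightarrow> bmat" is matprod
  using mnorm_le_matprod unfolding bounded_matrix_def by blast

lift_definition scaleR_bmat :: "real \<Rightarrow> bmat \<Rightarrow> bmat" is "\<lambda>r A n m. of_real r * A n m"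
  using mnorm_le_cmult unfolding bounded_matrix_def by blast

definition dist_bmat :: "bmat \<Rightarrow> bmat \<Rightarrow> real" where
  "dist_bmat A B = norm (A - B)"

definition sgn_bmat :: "bmat \<Rightarrow> bmat" where
  "sgn_bmat A = scaleR (inverse (norm A)) A"

definition uniformity_bmat :: "(bmat \<times> bmat) filter" where
  "uniformity_bmat = (INF e\<in>{0 <..}. principal {(x, y). dist x y < e})"

definition open_bmat :: "bmat set \<Rightarrow> bool" where
  "open_bmat S = (\<forall>x\<in>S. \<forall>\<^sub>F (x', y) in uniformity. x' = x \<longrightarrow> y \<in> S)"

text \<open>The infimum defining the norm is attained: the modulus of the form on any vectors of
  norm at most 1 is a lower bound of the set of admissible constants.\<close>

lemma mnorm_le_norm: "mnorm_le (entry A) (norm A)"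
proof -
  obtain K where K: "mnorm_le (entry A) K"
    using bounded_matrix_entry by (auto simp: bounded_matrix_def)
  have "cmod (mform (entry A) F x y) \<le> norm A"
    if "finite F" "(\<Sum>m\<in>F. (cmod (x m))\<^sup>2) \<le> 1" "(\<Sum>n\<in>F. (cmod (y n))\<^sup>2) \<le> 1" for F x y
    unfolding norm_bmat_def
  proof (rule cInf_greatest)
    show "{c. mnorm_le (entry A) c} \<noteq> {}" using K by auto
  qed (use that in \<open>auto simp: mnorm_le_def\<close>)
  then show ?thesis unfolding mnorm_le_def by blast
qed

lemma norm_bmat_le_iff: "norm A \<le> c \<longleftrightarrow> mnorm_le (entry A) c"
proof
  assume "mnorm_le (entry A) c"
  then show "norm A \<le> c"
    unfolding norm_bmat_def
    by (intro cInf_lower) (auto simp: bdd_below_def intro!: exI[of _ 0] mnorm_le_nonneg)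
qed (rule mnorm_le_mono[OF mnorm_le_norm])

lemma entry_mult_summable: "(\<lambda>k. entry A n k * entry B k m) summable_on UNIV"
  by (rule l2_prod_summable[OF row_l2_le[OF mnorm_le_norm] column_l2_le[OF mnorm_le_norm]])

lemma cmod_entry_le_norm: "cmod (entry A n m) \<le> norm A"
  by (rule mnorm_le_entry[OF mnorm_le_norm])

text \<open>Half of homogeneity; the instance proof obtains the reverse inequality by applying this
  one to \<open>inverse r\<close>.\<close>

lemma norm_bmat_scaleR_le: "norm (r *\<^sub>R A) \<le> \<bar>r\<bar> * norm (A :: bmat)"
  unfolding norm_bmat_le_iff scaleR_bmat.rep_eq
  using mnorm_le_cmult[OF mnorm_le_norm, of "of_real r" A] by simp

instance
proof
  fix a b c :: bmat and r s :: real
  show "a - b = a + - b" "a + b + c = a + (b + c)" "a + b = b + a" "0 + a = a" "- a + a = 0"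
    "r *\<^sub>R (a + b) = r *\<^sub>R a + r *\<^sub>R b" "(r + s) *\<^sub>R a = r *\<^sub>R a + s *\<^sub>R a"
    "r *\<^sub>R s *\<^sub>R a = (r * s) *\<^sub>R a" "1 *\<^sub>R a = a"
    by (rule bmat_eqI; simp add: minus_bmat.rep_eq plus_bmat.rep_eq uminus_bmat.rep_eq
        zero_bmat.rep_eq scaleR_bmat.rep_eq algebra_simps)+
  show "a * b * c = a * (b * c)"
    by (rule bmat_eqI)
       (simp add: times_bmat.rep_eq matprod_assoc[OF mnorm_le_norm mnorm_le_norm mnorm_le_norm])
  show "(a + b) * c = a * c + b * c" "a * (b + c) = a * b + a * c"
    by (rule bmat_eqI; simp add: times_bmat.rep_eq plus_bmat.rep_eq matprod_def algebra_simps
        infsum_add[OF entry_mult_summable entry_mult_summable])+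
  show "r *\<^sub>R a * b = r *\<^sub>R (a * b)" "a * r *\<^sub>R b = r *\<^sub>R (a * b)"
    by (rule bmat_eqI; simp add: times_bmat.rep_eq scaleR_bmat.rep_eq matprod_def mult.assoc
        mult.left_commute[of _ "complex_of_real r"] infsum_cmult_right')+
  show "1 * a = a"
  proof (rule bmat_eqI)
    fix n m
    have "entry (1 * a) n m = (\<Sum>\<^sub>\<infinity>k\<in>{n}. entry a k m)"
      unfolding times_bmat.rep_eq one_bmat.rep_eq matprod_def by (rule infsum_cong_neutral) auto
    then show "entry (1 * a) n m = entry a n m" by simp
  qed
  show "a * 1 = a"
  proof (rule bmat_eqI)
    fix n m
    have "entry (a * 1) n m = (\<Sum>\<^sub>\<infinity>k\<in>{m}. entry a n k)"
      unfolding times_bmat.rep_eq one_bmat.rep_eq matprod_def by (rule infsum_cong_neutral) auto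
    then show "entry (a * 1) n m = entry a n m" by simp
  qed
  have "entry 0 0 0 \<noteq> entry 1 0 0" by (simp add: zero_bmat.rep_eq one_bmat.rep_eq)
  then show "(0::bmat) \<noteq> 1" by metis
  show "dist a b = norm (a - b)" "sgn a = inverse (norm a) *\<^sub>R a"
    "uniformity = (INF e\<in>{0 <..}. principal {(x, y :: bmat). dist x y < e})"
    "open U = (\<forall>x\<in>U. \<forall>\<^sub>F (x', y) in uniformity. x' = x \<longrightarrow> y \<in> U)" for U :: "bmat set"
    by (rule dist_bmat_def sgn_bmat_def uniformity_bmat_def open_bmat_def)+
  show "norm a = 0 \<longleftrightarrow> a = 0"
  proof
    assume "norm a = 0"
    then show "a = 0"
      using cmod_entry_le_norm[of a] by (intro bmat_eqI) (simp add: zero_bmat.rep_eq)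
  next
    assume "a = 0"
    then have "norm a \<le> 0" by (simp add: norm_bmat_le_iff zero_bmat.rep_eq mnorm_le_zero)
    then show "norm a = 0" using mnorm_le_nonneg[OF mnorm_le_norm[of a]] by simp
  qed
  show "norm (a + b) \<le> norm a + norm b"
    unfolding norm_bmat_le_iff plus_bmat.rep_eq by (intro mnorm_le_add mnorm_le_norm)
  show "norm (a * b) \<le> norm a * norm b"
    unfolding norm_bmat_le_iff times_bmat.rep_eq by (intro mnorm_le_matprod mnorm_le_norm)
  show "norm (r *\<^sub>R a) = \<bar>r\<bar> * norm a"
  proof (cases "r = 0")
    case True
    have "norm (r *\<^sub>R a) \<ge> 0" by (rule mnorm_le_nonneg[OF mnorm_le_norm])
    then show ?thesis using norm_bmat_scaleR_le[of r a] True by simp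
  next
    case False
    have "inverse r *\<^sub>R r *\<^sub>R a = a"
      using False by (intro bmat_eqI) (simp add: scaleR_bmat.rep_eq)
    then have "norm a \<le> \<bar>inverse r\<bar> * norm (r *\<^sub>R a)"
      using norm_bmat_scaleR_le[of "inverse r" "r *\<^sub>R a"] by simp
    then have "\<bar>r\<bar> * norm a \<le> norm (r *\<^sub>R a)"
      using False by (simp add: field_simps)
    then show ?thesis using norm_bmat_scaleR_le[of r a] by simp
  qed
  show "norm (1 :: bmat) = 1"
  proof (rule antisym)
    show "norm (1 :: bmat) \<le> 1"
      unfolding norm_bmat_le_iff one_bmat.rep_eq by (rule mnorm_le_one)
    show "1 \<le> norm (1 :: bmat)"
      using cmod_entry_le_norm[of 1 0 0] by (simp add: one_bmat.rep_eq)
  qed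
qed

end

text \<open>Entries are dominated by the norm, so they converge to a matrix \<open>L\<close>. The
  work is to upgrade entrywise convergence to norm convergence.\<close>

instance bmat :: banach
proof
  fix X :: "nat \<Rightarrow> bmat" assume X: "Cauchy X"
  have "Cauchy (\<lambda>k. entry (X k) n m)" for n m
  proof (rule metric_CauchyI)
    fix e :: real assume "e > 0"
    then obtain N where N: "\<And>i j. i \<ge> N \<Longrightarrow> j \<ge> N \<Longrightarrow> dist (X i) (X j) < e"
      using X unfolding Cauchy_def by blast
    show "\<exists>N. \<forall>i\<ge>N. \<forall>j\<ge>N. dist (entry (X i) n m) (entry (X j) n m) < e"
    proof (intro exI allI impI)
      fix i j assume "i \<ge> N" "j \<ge> N"
      then show "dist (entry (X i) n m) (entry (X j) n m) < e"
        using N[of i j] cmod_entry_le_norm[of "X i - X j" n m]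
        by (simp add: dist_norm minus_bmat.rep_eq)
    qed
  qed
  then have "convergent (\<lambda>k. entry (X k) n m)" for n m
    by (rule Cauchy_convergent)
  then obtain L where L: "\<And>n m. (\<lambda>k. entry (X k) n m) \<longlonglongrightarrow> L n m"
    unfolding convergent_def by metis
  \<comment> \<open>A form on a finite section involves finitely many entries, so letting
    \<open>j\<close> tend to infinity in the Cauchy estimate keeps the bound, uniformly in
    \<open>F\<close>, \<open>x\<close> and \<open>y\<close>.\<close>
  have lim: "\<exists>N. \<forall>i\<ge>N. mnorm_le (\<lambda>n m. entry (X i) n m - L n m) e" if e: "e > 0" for e
  proof -
    obtain N where N: "\<And>i j. i \<ge> N \<Longrightarrow> j \<ge> N \<Longrightarrow> dist (X i) (X j) < e"
      using X e unfolding Cauchy_def by blast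
    show ?thesis
    proof (intro exI allI impI)
      fix i assume i: "i \<ge> N"
      show "mnorm_le (\<lambda>n m. entry (X i) n m - L n m) e"
        unfolding mnorm_le_def
      proof (intro allI impI)
        fix F and x y :: "int \<Rightarrow> complex"
        assume F: "finite F" "(\<Sum>m\<in>F. (cmod (x m))\<^sup>2) \<le> 1" "(\<Sum>n\<in>F. (cmod (y n))\<^sup>2) \<le> 1"
        have "(\<lambda>j. cmod (mform (\<lambda>n m. entry (X i) n m - entry (X j) n m) F x y))
            \<longlonglongrightarrow> cmod (mform (\<lambda>n m. entry (X i) n m - L n m) F x y)"
          unfolding mform_def by (intro tendsto_intros L)
        moreover have "cmod (mform (\<lambda>n m. entry (X i) n m - entry (X j) n m) F x y) \<le> e" if "j \<ge> N" for j
        proof -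
          have "mnorm_le (entry (X i - X j)) e"
            unfolding norm_bmat_le_iff[symmetric] using N[OF i that] by (simp add: dist_norm)
          from this[unfolded mnorm_le_def minus_bmat.rep_eq, rule_format, OF F]
          show ?thesis .
        qed
        ultimately show "cmod (mform (\<lambda>n m. entry (X i) n m - L n m) F x y) \<le> e"
          by (intro LIMSEQ_le_const2[where X="\<lambda>j. cmod (mform (\<lambda>n m. entry (X i) n m - entry (X j) n m) F x y)"]) blast+
      qed
    qed
  qed
  \<comment> \<open>\<open>L\<close> is bounded because it differs from the bounded matrix
    \<open>X N\<close> by a matrix of norm at most 1.\<close>
  obtain N where N: "mnorm_le (\<lambda>n m. entry (X N) n m - L n m) 1"
    using lim[of 1] by auto
  have "bounded_matrix L"
    unfolding bounded_matrix_def
    using mnorm_le_add[OF mnorm_le_norm[of "X N"] mnorm_le_uminus[OF N]] by auto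
  then have entryL: "entry (Bmat L) = L" by (simp add: Bmat_inverse)
  have "X \<longlonglongrightarrow> Bmat L"
  proof (rule metric_LIMSEQ_I)
    fix e :: real assume e: "e > 0"
    obtain N where N: "\<forall>i\<ge>N. mnorm_le (\<lambda>n m. entry (X i) n m - L n m) (e / 2)"
      using lim[of "e / 2"] e by auto
    have "dist (X i) (Bmat L) < e" if "i \<ge> N" for i
    proof -
      have "norm (X i - Bmat L) \<le> e / 2"
        unfolding norm_bmat_le_iff minus_bmat.rep_eq entryL using N that by blast
      then show ?thesis using e by (simp add: dist_norm)
    qed
    then show "\<exists>N. \<forall>i\<ge>N. dist (X i) (Bmat L) < e" by blast
  qed
  then show "convergent X" by (rule convergentI)
qed

section \<open>The inverse square root of the Gram matrix\<close>

definition inv_sqrt_series :: "'a::{real_normed_algebra_1,banach} \<Rightarrow> 'a" where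
  "inv_sqrt_series T = (\<Sum>k. ((-1/2 :: real) gchoose k) *\<^sub>R T ^ k)"

text \<open>The recurrence for the coefficients multiplies the modulus by
  \<open>(k + 3/2) / (k + 2)\<close>, which is below 1, starting from 1/2 at index 1. The bound 1/2,
  rather than 1, is what later gives strict coercivity.\<close>

lemma abs_gbinomial_minus_half_Suc_le: "\<bar>(-1/2 :: real) gchoose Suc k\<bar> \<le> 1/2"
proof (induction k)
  case (Suc k)
  let ?c = "\<lambda>k. (-1/2 :: real) gchoose k"
  have "- (real (Suc k) + 1/2) * ?c (Suc k) = real (Suc (Suc k)) * ?c (Suc (Suc k))"
    using gbinomial_mult_1[of "-1/2 :: real" "Suc k"] by (simp add: algebra_simps)
  then have "\<bar>real (Suc (Suc k)) * ?c (Suc (Suc k))\<bar> = (real (Suc k) + 1/2) * \<bar>?c (Suc k)\<bar>"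
    by (metis abs_minus_cancel abs_mult abs_of_nonneg add_nonneg_nonneg divide_nonneg_nonneg
        minus_mult_left of_nat_0_le_iff zero_le_numeral zero_le_one)
  also have "\<dots> \<le> real (Suc (Suc k)) * (1/2)"
    using Suc.IH by (intro mult_mono) auto
  finally have "real (Suc (Suc k)) * \<bar>?c (Suc (Suc k))\<bar> \<le> real (Suc (Suc k)) * (1/2)"
    by (simp only: abs_mult abs_of_nat)
  then show ?case
    by (rule mult_left_le_imp_le) simp
qed simp

lemma abs_gbinomial_minus_half_le: "\<bar>(-1/2 :: real) gchoose k\<bar> \<le> 1"
  using abs_gbinomial_minus_half_Suc_le[of "k - 1"] by (cases k) auto

text \<open>Vandermonde's identity with both exponents -1/2 gives the coefficients for exponent -1,
  that is, those of the geometric series of the inverse of \<open>1 + T\<close>.\<close>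

lemma sum_gbinomial_minus_half_convolution:
  "(\<Sum>i\<le>k. ((-1/2 :: real) gchoose i) * ((-1/2) gchoose (k - i))) = (-1) ^ k"
proof -
  have "(\<Sum>i\<le>k. ((-1/2 :: real) gchoose i) * ((-1/2) gchoose (k - i))) = (-1/2 + -1/2) gchoose k"
    using gbinomial_Vandermonde[of "-1/2 :: real" "-1/2" k] by (simp add: atLeast0AtMost)
  also have "\<dots> = (-1) ^ k * (real k gchoose k)"
    using gbinomial_minus[of "1 :: real" k] by simp
  also have "real k gchoose k = 1"
    using binomial_gbinomial[of k k] by (metis binomial_n_n of_nat_1)
  finally show ?thesis by simp
qed

context
  fixes T :: "'a::{real_normed_algebra_1,banach}"
  assumes T: "norm T \<le> 1/2"
begin

lemma norm_power_le_half_power: "norm (T ^ k) \<le> (1/2) ^ k"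
  by (rule order_trans[OF norm_power_ineq power_mono[OF T norm_ge_zero]])

lemma norm_inv_sqrt_term_le: "norm (((-1/2 :: real) gchoose k) *\<^sub>R T ^ k) \<le> (1/2) ^ k"
  using mult_mono[OF abs_gbinomial_minus_half_le norm_power_le_half_power, of k] by simp

lemma summable_norm_inv_sqrt_term: "summable (\<lambda>k. norm (((-1/2 :: real) gchoose k) *\<^sub>R T ^ k))"
  by (rule summable_comparison_test[OF _ summable_geometric[of "1/2::real"]])
     (use norm_inv_sqrt_term_le in auto)

lemma summable_inv_sqrt_term: "summable (\<lambda>k. ((-1/2 :: real) gchoose k) *\<^sub>R T ^ k)"
  by (rule summable_norm_cancel[OF summable_norm_inv_sqrt_term])

lemma summable_alternating_power: "summable (\<lambda>k. (-1) ^ k *\<^sub>R T ^ k)"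
proof (rule summable_norm_cancel, rule summable_comparison_test[OF _ summable_geometric[of "1/2::real"]])
  show "\<exists>N. \<forall>n\<ge>N. norm (norm ((-1) ^ n *\<^sub>R T ^ n)) \<le> (1/2) ^ n"
    using norm_power_le_half_power by (auto simp: power_abs)
qed simp

lemma inv_sqrt_series_sq:
  "inv_sqrt_series T * inv_sqrt_series T = (\<Sum>k. (-1) ^ k *\<^sub>R T ^ k)"
proof -
  have "(\<Sum>i\<le>k. (((-1/2 :: real) gchoose i) *\<^sub>R T ^ i) * (((-1/2 :: real) gchoose (k - i)) *\<^sub>R T ^ (k - i)))
      = (-1) ^ k *\<^sub>R T ^ k" for k
  proof -
    have "(\<Sum>i\<le>k. (((-1/2 :: real) gchoose i) *\<^sub>R T ^ i) * (((-1/2 :: real) gchoose (k - i)) *\<^sub>R T ^ (k - i)))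
       = (\<Sum>i\<le>k. (((-1/2 :: real) gchoose i) * ((-1/2 :: real) gchoose (k - i))) *\<^sub>R T ^ k)"
      by (intro sum.cong refl) (simp add: power_add[symmetric])
    then show ?thesis
      by (simp only: scaleR_sum_left[symmetric] sum_gbinomial_minus_half_convolution)
  qed
  then show ?thesis
    unfolding inv_sqrt_series_def
    using Cauchy_product[OF summable_norm_inv_sqrt_term summable_norm_inv_sqrt_term] by simp
qed

text \<open>The square is the alternating geometric series. Multiplying it by \<open>T\<close>
  shifts the index and flips the sign, so everything but the constant term cancels.\<close>

lemma inv_sqrt_series_sq_mult: "inv_sqrt_series T * inv_sqrt_series T * (1 + T) = 1"
proof -
  let ?f = "\<lambda>k. (-1) ^ k *\<^sub>R T ^ k"
  have "(\<Sum>k. ?f k) * T = (\<Sum>k. ?f k * T)"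
    by (rule suminf_mult2[OF summable_alternating_power])
  also have "\<dots> = (\<Sum>k. - ?f (Suc k))"
    by (simp add: power_commutes)
  also have "\<dots> = - (\<Sum>k. ?f (Suc k))"
    by (rule suminf_minus[OF summable_ignore_initial_segment[OF summable_alternating_power, of 1, simplified Suc_eq_plus1[symmetric]]])
  also have "(\<Sum>k. ?f (Suc k)) = (\<Sum>k. ?f k) - 1"
    using suminf_split_head[OF summable_alternating_power] by simp
  finally show ?thesis
    unfolding inv_sqrt_series_sq by (simp add: distrib_left)
qed

lemma inv_sqrt_series_commute:
  assumes "D * T = T * D"
  shows "D * inv_sqrt_series T = inv_sqrt_series T * D"
proof -
  have "T ^ k * D = D * T ^ k" for k
    by (rule power_commuting_commutes) (simp add: assms)
  then show ?thesis
    unfolding inv_sqrt_series_def suminf_mult[OF summable_inv_sqrt_term, symmetric]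
      suminf_mult2[OF summable_inv_sqrt_term] by simp
qed

text \<open>The constant term is 1, and the rest is dominated by a geometric series with first term
  1/4 and ratio 1/2. A distance from 1 below 1 makes the series bounded below.\<close>

lemma norm_inv_sqrt_series_minus_one: "norm (inv_sqrt_series T - 1) \<le> 1/2"
proof -
  let ?f = "\<lambda>k. ((-1/2 :: real) gchoose k) *\<^sub>R T ^ k"
  have le: "norm (?f (Suc k)) \<le> 1/4 * (1/2) ^ k" for k
    using mult_mono[OF abs_gbinomial_minus_half_Suc_le norm_power_le_half_power[of "Suc k"], of k]
    by (simp del: gbinomial_Suc_Suc)
  have s: "summable (\<lambda>k. norm (?f (Suc k)))"
    using summable_norm_inv_sqrt_term by (simp only: summable_Suc_iff[of "\<lambda>k. norm (?f k)"])
  have "inv_sqrt_series T - 1 = (\<Sum>k. ?f (Suc k))"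
    unfolding inv_sqrt_series_def using suminf_split_head[OF summable_inv_sqrt_term] by simp
  also have "norm \<dots> \<le> (\<Sum>k. norm (?f (Suc k)))"
    by (rule summable_norm[OF s])
  also have "\<dots> \<le> (\<Sum>k. 1/4 * (1/2) ^ k)"
    by (rule suminf_le[OF le s]) (intro summable_mult summable_geometric, simp)
  also have "\<dots> = 1/4 * (\<Sum>k. (1/2) ^ k :: real)"
    by (rule suminf_mult) (intro summable_geometric, simp)
  also have "\<dots> = 1/2" by (simp add: suminf_geometric)
  finally show ?thesis .
qed

end

section \<open>Adjoints and coercive matrices\<close>

lift_definition adj :: "bmat \<Rightarrow> bmat" is "\<lambda>A n m. cnj (A m n)"
  using mnorm_le_cnj_transpose unfolding bounded_matrix_def by blast

lemma adj_mult: "adj (A * B) = adj B * adj A"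
  by (rule bmat_eqI) (simp add: adj.rep_eq times_bmat.rep_eq matprod_def mult.commute flip: infsum_cnj)

lemma adj_one [simp]: "adj 1 = 1"
  by (rule bmat_eqI) (simp add: adj.rep_eq one_bmat.rep_eq)

lemma norm_adj_le: "norm (adj A) \<le> norm A"
  unfolding norm_bmat_le_iff adj.rep_eq by (rule mnorm_le_cnj_transpose[OF mnorm_le_norm])

text \<open>Continuity lets the adjoint be taken termwise in \<open>inv_sqrt_series\<close>.\<close>

lemma bounded_linear_adj: "bounded_linear adj"
  by (rule bounded_linear_intro[where K=1])
     (auto intro: bmat_eqI norm_adj_le simp: adj.rep_eq plus_bmat.rep_eq scaleR_bmat.rep_eq)

lemma adj_eq_iff: "adj A = A \<longleftrightarrow> (\<forall>n m. entry A n m = cnj (entry A m n))"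
  by (metis adj.rep_eq bmat_eqI)

lemma adj_power: "adj A = A \<Longrightarrow> adj (A ^ k) = A ^ k"
  by (induction k) (simp_all add: adj_mult power_commutes)

lemma adj_inv_sqrt_series:
  assumes "norm T \<le> 1/2" "adj T = T"
  shows "adj (inv_sqrt_series T) = inv_sqrt_series T"
proof -
  interpret bounded_linear adj by (rule bounded_linear_adj)
  show ?thesis
    unfolding inv_sqrt_series_def suminf[OF summable_inv_sqrt_term[OF assms(1)]]
    by (simp add: scaleR adj_power[OF assms(2)])
qed

text \<open>A lower bound for the quadratic form on finitely supported vectors. For
  \<open>d = 0\<close> it is the positivity clause in the description of
  \<open>Cmat\<close>.\<close>

definition coercive :: "real \<Rightarrow> bmat \<Rightarrow> bool" where
  "coercive d A \<longleftrightarrow> (\<forall>F x. finite F \<longrightarrow> d * (\<Sum>n\<in>F. (cmod (x n))\<^sup>2) \<le> Re (mform (entry A) F x x))"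

text \<open>The identity contributes the squared norm exactly, and \<open>A - 1\<close> can lower it
  by at most the fraction \<open>c\<close>.\<close>

lemma coercive_of_norm_minus_one:
  assumes "norm (A - 1) \<le> c"
  shows "coercive (1 - c) A"
  unfolding coercive_def
proof (intro allI impI)
  fix F :: "int set" and x :: "int \<Rightarrow> complex" assume F: "finite F"
  let ?s = "\<Sum>n\<in>F. (cmod (x n))\<^sup>2"
  have one: "mform (entry 1) F x x = of_real ?s"
    unfolding mform_def one_bmat.rep_eq of_real_sum
    by (intro sum.cong refl)
       (use F in \<open>simp only: complex_norm_square, simp add: if_distrib if_distribR mult.commute cong: if_cong\<close>)
  have "cmod (mform (entry (A - 1)) F x x) \<le> c * L2_set (\<lambda>m. cmod (x m)) F * L2_set (\<lambda>m. cmod (x m)) F"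
    using assms unfolding norm_bmat_le_iff by (rule mform_bound[OF _ F])
  also have "\<dots> = c * ?s"
    by (simp add: L2_set_def mult.assoc sum_nonneg)
  finally have "- (c * ?s) \<le> Re (mform (entry (A - 1)) F x x)"
    using abs_Re_le_cmod[of "mform (entry (A - 1)) F x x"] by linarith
  then show "(1 - c) * ?s \<le> Re (mform (entry A) F x x)"
    unfolding minus_bmat.rep_eq mform_diff one by (simp add: left_diff_distrib)
qed

lemma coercive_add: "coercive c A \<Longrightarrow> coercive d B \<Longrightarrow> coercive (c + d) (A + B)"
  unfolding coercive_def plus_bmat.rep_eq mform_add distrib_right by (auto intro: add_mono)

lemma coercive_scaleR: "coercive c A \<Longrightarrow> 0 \<le> r \<Longrightarrow> coercive (r * c) (r *\<^sub>R A)"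
  unfolding coercive_def scaleR_bmat.rep_eq mform_cmult by (auto simp: mult.assoc intro: mult_left_mono)

text \<open>Each column \<open>x\<close> of \<open>X\<close> satisfies \<open>M x = 0\<close>, so
  the quadratic form on the sections of \<open>x\<close> tends to zero, while coercivity keeps it
  above \<open>d\<close> times the squared modulus of any single entry.\<close>

lemma coercive_mult_eq_0:
  assumes M: "coercive d M" "d > 0" and MX: "M * X = 0"
  shows "X = 0"
proof (rule bmat_eqI)
  fix n m
  define x where "x k = entry X k m" for k
  have x: "l2_le x ((norm X)\<^sup>2)"
    unfolding x_def by (rule column_l2_le[OF mnorm_le_norm])
  have "matvec (entry M) x k = entry (M * X) k m" for k
    by (simp add: matvec_def times_bmat.rep_eq matprod_def x_def)
  then have "((\<lambda>F. mform (entry M) F x x) \<longlongrightarrow> 0) (finite_subsets_at_top UNIV)"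
    using mform_tendsto[OF mnorm_le_norm x x, of M] by (simp add: MX zero_bmat.rep_eq)
  then have lim: "((\<lambda>F. Re (mform (entry M) F x x)) \<longlongrightarrow> 0) (finite_subsets_at_top UNIV)"
    using tendsto_Re by fastforce
  have "d * (cmod (x n))\<^sup>2 \<le> Re (mform (entry M) F x x)" if F: "finite F" "n \<in> F" for F
  proof -
    have "d * (cmod (x n))\<^sup>2 \<le> d * (\<Sum>n\<in>F. (cmod (x n))\<^sup>2)"
      using F M(2) by (intro mult_left_mono member_le_sum) auto
    also have "\<dots> \<le> Re (mform (entry M) F x x)"
      using M(1) F by (simp add: coercive_def)
    finally show ?thesis .
  qed
  then have "\<forall>\<^sub>F F in finite_subsets_at_top UNIV. d * (cmod (x n))\<^sup>2 \<le> Re (mform (entry M) F x x)"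
    unfolding eventually_finite_subsets_at_top by (intro exI[of _ "{n}"]) auto
  then have "d * (cmod (x n))\<^sup>2 \<le> 0"
    by (rule tendsto_lowerbound[OF lim]) simp
  then show "entry X n m = entry 0 n m"
    using M(2) by (simp add: mult_le_0_iff x_def zero_bmat.rep_eq)
qed

text \<open>Inserting \<open>G * (D * D) = 1\<close> on the left and cancelling
  \<open>D * D * G = 1\<close> on the right moves \<open>G\<close> across \<open>D\<close>.\<close>

lemma commute_of_sq_inverse:
  fixes D G :: "'a::monoid_mult"
  assumes "D * D * G = 1" "G * (D * D) = 1"
  shows "D * G = G * D"
proof -
  have "D * G = (G * (D * D)) * (D * G)" by (simp add: assms)
  also have "\<dots> = G * D * (D * D * G)" by (simp only: mult.assoc)
  finally show ?thesis by (simp add: assms)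
qed

section \<open>The Gram matrix in closed form\<close>

text \<open>Schur test: each row and column has exactly two nonzero entries, both 1/4.\<close>

lemma mnorm_le_tri: "mnorm_le (\<lambda>n m. if \<bar>n - m\<bar> = 1 then 1/4 else 0) (1/2)"
proof -
  have row: "(\<Sum>n\<in>F. cmod (if \<bar>n - m\<bar> = 1 then 1/4 else 0)) \<le> 1/2" if "finite F" for F and m :: int
  proof -
    have "(\<Sum>n\<in>F. cmod (if \<bar>n - m\<bar> = 1 then 1/4 else 0))
        \<le> (\<Sum>n\<in>F \<union> {m - 1, m + 1}. cmod (if \<bar>n - m\<bar> = 1 then 1/4 else 0))"
      using that by (intro sum_mono2) auto
    also have "\<dots> = (\<Sum>n\<in>{m - 1, m + 1}. cmod (if \<bar>n - m\<bar> = 1 then 1/4 else 0))"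
      using that by (intro sum.mono_neutral_right) auto
    finally show ?thesis by simp
  qed
  show ?thesis
    by (rule mnorm_le_schur) (use row in \<open>auto simp: abs_minus_commute\<close>)
qed

lift_definition tri :: bmat is "\<lambda>n m. if \<bar>n - m\<bar> = 1 then 1/4 else 0"
  using mnorm_le_tri unfolding bounded_matrix_def by blast

lemma norm_tri_le: "norm tri \<le> 1/2"
  unfolding norm_bmat_le_iff tri.rep_eq by (rule mnorm_le_tri)

lemma adj_tri: "adj tri = tri"
  by (rule bmat_eqI) (simp add: adj.rep_eq tri.rep_eq abs_minus_commute)

lemma phi0_phi0_integral: "(LINT x|lborel. phi0 x * phi0 x) = 2/3"
proof -
  \<comment> \<open>Both closed intervals contain 0, where each piece has value 1, so one copy is
    subtracted.\<close>
  have eq: "phi0 x * phi0 x = ((1 + x)\<^sup>2 * indicator {-1..0} x + (1 - x)\<^sup>2 * indicator {0..1} x) - indicator {0} x" for x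
    by (auto simp: phi0_def indicator_def max_def power2_eq_square)
  have 1: "has_bochner_integral lborel (\<lambda>x::real. (1 + x)\<^sup>2 * indicator {-1..0} x) ((1 + 0)^3/3 - (1 + (-1))^3/3)"
    by (rule has_bochner_integral_FTC_Icc_real[where F="\<lambda>x. (1 + x)^3 / 3"])
       (auto intro!: derivative_eq_intros continuous_intros simp: power2_eq_square)
  have 2: "has_bochner_integral lborel (\<lambda>x::real. (1 - x)\<^sup>2 * indicator {0..1} x) (- ((1 - 1)^3/3) - (- ((1 - 0)^3/3)))"
    by (rule has_bochner_integral_FTC_Icc_real[where F="\<lambda>x. - ((1 - x)^3 / 3)"])
       (auto intro!: derivative_eq_intros continuous_intros simp: power2_eq_square)
  have 3: "has_bochner_integral lborel (\<lambda>x::real. indicator {0} x :: real) (measure lborel {0::real})"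
    by (rule has_bochner_integral_real_indicator) auto
  show ?thesis
    unfolding eq
    using has_bochner_integral_diff[OF has_bochner_integral_add[OF 1 2] 3]
    by (simp add: has_bochner_integral_iff)
qed

lemma phi0_phi1_integral: "(LINT x|lborel. phi0 x * phi0 (x - 1)) = 1/6"
proof -
  have eq: "phi0 x * phi0 (x - 1) = (x - x\<^sup>2) * indicator {0..1} x" for x
    by (auto simp: phi0_def indicator_def max_def power2_eq_square algebra_simps)
  have "(LINT x|lborel. (x - x\<^sup>2) * indicator {0..1::real} x) = (1^2/2 - 1^3/3) - (0^2/2 - 0^3/3)"
    by (rule integral_FTC_Icc_real[where F="\<lambda>x. x^2/2 - x^3/3"])
       (auto intro!: derivative_eq_intros continuous_intros simp: power2_eq_square)
  then show ?thesis unfolding eq by simp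
qed

lemma gram_shift: "gram n m = of_real (LINT x|lborel. phi0 x * phi0 (x - of_int (m - n)))"
  unfolding gram_def phi_def
  by (subst lborel_integral_real_affine[where c=1 and t="of_int n"]) (auto simp: algebra_simps)

lemma gram_commute: "gram n m = gram m n"
  by (simp add: gram_def mult.commute)

lemma gram_eq: "gram n m = (if n = m then 2/3 else if \<bar>n - m\<bar> = 1 then 1/6 else 0)"
proof -
  consider "n = m" | "m - n = 1" | "n - m = 1" | "\<bar>m - n\<bar> \<ge> 2" by linarith
  then show ?thesis
  proof cases
    case 4
    then have "\<bar>real_of_int (m - n)\<bar> \<ge> 2" by linarith
    then have "phi0 x * phi0 (x - of_int (m - n)) = 0" for x
      by (auto simp: phi0_def max_def)
    then show ?thesis using 4 unfolding gram_shift by (simp only:) auto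
  next
    case 1 then show ?thesis by (simp add: gram_shift phi0_phi0_integral)
  next
    case 2 then show ?thesis by (auto simp: gram_shift phi0_phi1_integral simp del: of_int_diff)
  next
    case 3
    then show ?thesis
      by (subst gram_commute) (auto simp: gram_shift phi0_phi1_integral simp del: of_int_diff)
  qed
qed

text \<open>Factoring out the diagonal value 2/3 leaves off-diagonal entries 1/4, so the
  perturbation \<open>tri\<close> of the identity has norm at most 1/2.\<close>

definition gram_bmat :: bmat where
  "gram_bmat = (2/3) *\<^sub>R (1 + tri)"

lemma entry_gram_bmat: "entry gram_bmat = gram"
  by (intro ext)
     (simp add: gram_bmat_def scaleR_bmat.rep_eq plus_bmat.rep_eq one_bmat.rep_eq tri.rep_eq gram_eq)

section \<open>Existence and uniqueness of the positive inverse square root\<close>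

text \<open>The scalar \<open>sqrt (3/2)\<close> is the inverse square root of the factor 2/3 in
  \<open>gram_bmat\<close>.\<close>

definition gram_inv_sqrt :: bmat where
  "gram_inv_sqrt = sqrt (3/2) *\<^sub>R inv_sqrt_series tri"

lemma gram_inv_sqrt_sq: "gram_inv_sqrt * gram_inv_sqrt * gram_bmat = 1"
  by (simp add: gram_inv_sqrt_def gram_bmat_def inv_sqrt_series_sq_mult[OF norm_tri_le])

lemma adj_gram_inv_sqrt: "adj gram_inv_sqrt = gram_inv_sqrt"
proof -
  interpret bounded_linear adj by (rule bounded_linear_adj)
  show ?thesis
    by (simp add: gram_inv_sqrt_def scaleR adj_inv_sqrt_series[OF norm_tri_le adj_tri])
qed

lemma adj_gram_bmat: "adj gram_bmat = gram_bmat"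
  unfolding adj_eq_iff entry_gram_bmat by (metis complex_cnj_complex_of_real gram_commute gram_def)

lemma coercive_gram_inv_sqrt: "coercive (sqrt (3/2) / 2) gram_inv_sqrt"
  using coercive_scaleR[OF coercive_of_norm_minus_one[OF norm_inv_sqrt_series_minus_one[OF norm_tri_le]], of "sqrt (3/2)"]
  by (simp add: gram_inv_sqrt_def)

lemma gram_inv_sqrt_unique:
  assumes D: "adj D = D" "coercive 0 D" "D * D * gram_bmat = 1"
  shows "D = gram_inv_sqrt"
proof -
  let ?A = gram_inv_sqrt and ?G = gram_bmat
  \<comment> \<open>Taking adjoints turns the left inverse \<open>X * X\<close> of the Gram matrix
    into a two-sided one.\<close>
  have adjG: "?G * (X * X) = 1" if "adj X = X" "X * X * ?G = 1" for X
    using arg_cong[OF that(2), of adj] by (simp add: adj_mult adj_gram_bmat that(1))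
  have DG: "D * ?G = ?G * D"
    by (rule commute_of_sq_inverse[OF D(3) adjG[OF D(1,3)]])
  have "tri = (3/2) *\<^sub>R ?G - 1" by (simp add: gram_bmat_def)
  then have "D * tri = tri * D" by (metis DG left_diff_distrib right_diff_distrib mult_1_left mult_1_right mult_scaleR_left mult_scaleR_right)
  then have DA: "D * ?A = ?A * D"
    by (simp add: gram_inv_sqrt_def inv_sqrt_series_commute[OF norm_tri_le])
  have "D * D = D * D * (?G * (?A * ?A))"
    by (simp add: adjG[OF adj_gram_inv_sqrt gram_inv_sqrt_sq])
  also have "\<dots> = ?A * ?A" by (simp only: mult.assoc[symmetric] D(3) mult_1_left)
  \<comment> \<open>Since \<open>D\<close> commutes with \<open>gram_inv_sqrt\<close>, the cross
    terms cancel and the difference of the equal squares remains.\<close>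
  finally have "(?A + D) * (?A - D) = 0"
    by (simp add: distrib_right right_diff_distrib DA)
  moreover have "coercive (sqrt (3/2) / 2 + 0) (?A + D)"
    by (rule coercive_add[OF coercive_gram_inv_sqrt D(2)])
  ultimately have "?A - D = 0"
    by (rule coercive_mult_eq_0[rotated 2]) simp
  then show ?thesis by simp
qed

text \<open>The definite description is evaluated by checking its clauses for
  \<open>gram_inv_sqrt\<close> and transferring any other candidate to \<open>bmat\<close>, where
  uniqueness is known.\<close>

lemma Cmat_eq: "Cmat = entry gram_inv_sqrt"
  unfolding Cmat_def
proof (rule the_equality)
  have "matprod (matprod (entry gram_inv_sqrt) (entry gram_inv_sqrt)) gram = entry 1"
    unfolding gram_inv_sqrt_sq[symmetric] by (simp add: times_bmat.rep_eq entry_gram_bmat)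
  moreover have "0 \<le> Re (mform (entry gram_inv_sqrt) F x x)" if "finite F" for F x
  proof -
    have "0 \<le> sqrt (3/2) / 2 * (\<Sum>n\<in>F. (cmod (x n))\<^sup>2)" by (simp add: sum_nonneg)
    also have "\<dots> \<le> Re (mform (entry gram_inv_sqrt) F x x)"
      using coercive_gram_inv_sqrt that by (simp only: coercive_def)
    finally show ?thesis .
  qed
  ultimately show "bounded_matrix (entry gram_inv_sqrt)
    \<and> (\<forall>n m. entry gram_inv_sqrt n m = cnj (entry gram_inv_sqrt m n))
    \<and> (\<forall>F x. finite F \<longrightarrow> 0 \<le> Re (mform (entry gram_inv_sqrt) F x x))
    \<and> (\<forall>n m. matprod (matprod (entry gram_inv_sqrt) (entry gram_inv_sqrt)) gram n m = (if n = m then 1 else 0))"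
    using adj_gram_inv_sqrt[unfolded adj_eq_iff] bounded_matrix_entry[of gram_inv_sqrt]
    unfolding one_bmat.rep_eq by (intro conjI) (blast, blast, blast, simp only: simp_thms)
next
  fix C
  assume C: "bounded_matrix C \<and> (\<forall>n m. C n m = cnj (C m n))
    \<and> (\<forall>F x. finite F \<longrightarrow> 0 \<le> Re (mform C F x x))
    \<and> (\<forall>n m. matprod (matprod C C) gram n m = (if n = m then 1 else 0))"
  then have ent: "entry (Bmat C) = C" by (intro Bmat_inverse) blast
  have "Bmat C = gram_inv_sqrt"
  proof (rule gram_inv_sqrt_unique)
    show "adj (Bmat C) = Bmat C" unfolding adj_eq_iff ent using C by blast
    show "coercive 0 (Bmat C)" unfolding coercive_def ent using C by (simp only: mult_zero_left) blast
    show "Bmat C * Bmat C * gram_bmat = 1"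
      using C by (intro bmat_eqI) (simp only: times_bmat.rep_eq entry_gram_bmat ent one_bmat.rep_eq)
  qed
  then show "C = entry gram_inv_sqrt" using ent by simp
qed

lemma bounded_matrix_Cmat: "bounded_matrix Cmat"
  unfolding Cmat_eq by (rule bounded_matrix_entry)

section \<open>Piecewise linear synthesis\<close>

text \<open>Synthesis without the factor \<open>Cmat\<close>: U_t first applies \<open>Cmat\<close>
  and then \<open>synth t\<close>. The sum is locally finite, so arbitrary coefficients are
  allowed.\<close>

definition synth :: "real \<Rightarrow> (int \<Rightarrow> complex) \<Rightarrow> real \<Rightarrow> complex" where
  "synth t c x = infsum (\<lambda>m. c m * complex_of_real (phit t m x)) UNIV"

lemma psi_eq_synth: "psi t n = synth t (\<lambda>m. Cmat m n)"
  by (rule ext) (simp add: psi_def synth_def)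

lemma phi0_lipschitz: "\<bar>phi0 x - phi0 y\<bar> \<le> \<bar>x - y\<bar>"
  by (auto simp: phi0_def max_def abs_if)

lemma phi_eq_0: "m \<notin> {\<lfloor>z\<rfloor>, \<lfloor>z\<rfloor> + 1} \<Longrightarrow> phi m z = 0"
proof -
  assume "m \<notin> {\<lfloor>z\<rfloor>, \<lfloor>z\<rfloor> + 1}"
  then have "m \<le> \<lfloor>z\<rfloor> - 1 \<or> m \<ge> \<lfloor>z\<rfloor> + 2" by auto
  then have "real_of_int m \<le> of_int \<lfloor>z\<rfloor> - 1 \<or> real_of_int m \<ge> of_int \<lfloor>z\<rfloor> + 2" by linarith
  moreover have "of_int \<lfloor>z\<rfloor> \<le> z" "z < of_int \<lfloor>z\<rfloor> + 1" by linarith+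
  ultimately have "1 \<le> \<bar>z - of_int m\<bar>" by linarith
  then show "phi m z = 0"
    by (simp add: phi_def phi0_def)
qed

lemma phi_floor: "phi \<lfloor>z\<rfloor> z = 1 - frac z" "phi (\<lfloor>z\<rfloor> + 1) z = frac z"
proof -
  have z: "of_int \<lfloor>z\<rfloor> \<le> z" "z < of_int \<lfloor>z\<rfloor> + 1" by linarith+
  then have "\<bar>z - of_int \<lfloor>z\<rfloor>\<bar> = frac z" "\<bar>z - of_int (\<lfloor>z\<rfloor> + 1)\<bar> = 1 - frac z"
    by (simp_all add: frac_def)
  then show "phi \<lfloor>z\<rfloor> z = 1 - frac z" "phi (\<lfloor>z\<rfloor> + 1) z = frac z"
    using z frac_ge_0[of z] frac_lt_1[of z] unfolding phi_def phi0_def by simp_all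
qed

text \<open>Any finite set containing the two active nodes will do, so two different points can
  share one index set.\<close>

lemma synth_eq_sum:
  assumes "finite I" "{\<lfloor>x / t\<rfloor>, \<lfloor>x / t\<rfloor> + 1} \<subseteq> I"
  shows "synth t c x = of_real (t powr (-1/2)) * (\<Sum>m\<in>I. c m * of_real (phi m (x / t)))"
proof -
  have "synth t c x = (\<Sum>\<^sub>\<infinity>m\<in>I. c m * of_real (phit t m x))"
    unfolding synth_def
  proof (rule infsum_cong_neutral)
    fix m assume "m \<in> UNIV - I"
    then have "phi m (x / t) = 0" using assms(2) by (intro phi_eq_0) auto
    then show "c m * of_real (phit t m x) = 0" by (simp add: phit_def)
  qed auto
  then show ?thesis using assms(1) by (simp add: phit_def sum_distrib_left mult_ac)
qed

text \<open>Up to scaling, this is linear interpolation between the values at neighbouring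
  integers.\<close>

lemma synth_eq:
  "synth t c x = of_real (t powr (-1/2)) *
     (c \<lfloor>x / t\<rfloor> * of_real (1 - frac (x / t)) + c (\<lfloor>x / t\<rfloor> + 1) * of_real (frac (x / t)))"
  by (subst synth_eq_sum[of "{\<lfloor>x / t\<rfloor>, \<lfloor>x / t\<rfloor> + 1}"]) (simp_all add: phi_floor)

lemma synth_sum: "synth t (\<lambda>m. \<Sum>n\<in>F. a n * d n m) x = (\<Sum>n\<in>F. a n * synth t (d n) x)"
  unfolding synth_eq
  by (simp only: distrib_left sum_distrib_left sum_distrib_right sum.distrib) (simp add: mult_ac)

lemma cmod_convex_le:
  assumes "0 \<le> r" "r \<le> 1"
  shows "cmod (a * of_real (1 - r) + b * of_real r) \<le> cmod a * (1 - r) + cmod b * r"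
proof -
  have "cmod (a * of_real (1 - r) + b * of_real r) \<le> cmod (a * of_real (1 - r)) + cmod (b * of_real r)"
    by (rule norm_triangle_ineq)
  also have "\<dots> = cmod a * (1 - r) + cmod b * r"
    using assms by (simp add: norm_mult del: of_real_diff)
  finally show ?thesis .
qed

lemma cmod_synth_le:
  assumes "\<And>m. cmod (c m) \<le> K"
  shows "cmod (synth t c x) \<le> t powr (-1/2) * K"
proof -
  let ?r = "frac (x / t)" and ?k = "\<lfloor>x / t\<rfloor>"
  have r: "0 \<le> ?r" "?r \<le> 1" using frac_ge_0 frac_lt_1[of "x / t"] by auto
  have "cmod (c ?k * of_real (1 - ?r) + c (?k + 1) * of_real ?r) \<le> cmod (c ?k) * (1 - ?r) + cmod (c (?k + 1)) * ?r"
    by (rule cmod_convex_le[OF r])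
  also have "\<dots> \<le> K * (1 - ?r) + K * ?r"
    using r by (intro add_mono mult_right_mono assms) auto
  also have "\<dots> = K" by (simp add: algebra_simps)
  finally show ?thesis
    unfolding synth_eq norm_mult by (simp add: mult_left_mono)
qed

lemma cmod_synth_sq_le:
  assumes "t > 0"
  shows "(cmod (synth t c x))\<^sup>2 \<le> (cmod (c \<lfloor>x / t\<rfloor>))\<^sup>2 / t + (cmod (c (\<lfloor>x / t\<rfloor> + 1)))\<^sup>2 / t"
proof -
  let ?r = "frac (x / t)" and ?k = "\<lfloor>x / t\<rfloor>"
  have r: "0 \<le> ?r" "?r \<le> 1" using frac_ge_0 frac_lt_1[of "x / t"] by auto
  have convex: "(a * (1 - r) + b * r)\<^sup>2 \<le> a\<^sup>2 + b\<^sup>2" if "0 \<le> r" "r \<le> 1" for a b r :: real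
  proof -
    \<comment> \<open>The defect is written as a sum of nonnegative terms: the variance of the
      convex combination and the remaining weights of the two squares.\<close>
    have "a\<^sup>2 + b\<^sup>2 - (a * (1 - r) + b * r)\<^sup>2 = r * (1 - r) * (a - b)\<^sup>2 + a\<^sup>2 * r + b\<^sup>2 * (1 - r)"
      by (simp add: power2_eq_square algebra_simps)
    also have "\<dots> \<ge> 0" using that by simp
    finally show ?thesis by simp
  qed
  have "(cmod (c ?k * of_real (1 - ?r) + c (?k + 1) * of_real ?r))\<^sup>2
     \<le> (cmod (c ?k) * (1 - ?r) + cmod (c (?k + 1)) * ?r)\<^sup>2"
    by (intro power_mono cmod_convex_le r) auto
  also have "\<dots> \<le> (cmod (c ?k))\<^sup>2 + (cmod (c (?k + 1)))\<^sup>2"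
    by (rule convex[OF r])
  finally have "(t powr (-1/2))\<^sup>2 * (cmod (c ?k * of_real (1 - ?r) + c (?k + 1) * of_real ?r))\<^sup>2
     \<le> (t powr (-1/2))\<^sup>2 * ((cmod (c ?k))\<^sup>2 + (cmod (c (?k + 1)))\<^sup>2)"
    by (rule mult_left_mono) simp
  moreover have "(t powr (-1/2))\<^sup>2 = 1 / t"
    using assms by (simp add: power2_eq_square powr_add[symmetric] powr_minus_divide)
  ultimately show ?thesis
    unfolding synth_eq norm_mult power_mult_distrib by (simp add: add_divide_distrib)
qed

text \<open>The difference splits into a change of the scaling factor and a change of the
  interpolation point. At most four hats are active at the two points and each is 1-Lipschitz, hence
  the factor 4. Equal points give dependence on the scale; equal scales give continuity in the
  point.\<close>

lemma synth_diff_le: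
  assumes K: "\<And>m. cmod (c m) \<le> K"
  shows "cmod (synth s c x - synth t c y)
    \<le> K * (\<bar>s powr (-1/2) - t powr (-1/2)\<bar> + t powr (-1/2) * 4 * \<bar>x / s - y / t\<bar>)"
proof -
  define u where "u z = (c \<lfloor>z\<rfloor> * of_real (1 - frac z) + c (\<lfloor>z\<rfloor> + 1) * of_real (frac z))" for z
  define I where "I = {\<lfloor>x / s\<rfloor>, \<lfloor>x / s\<rfloor> + 1, \<lfloor>y / t\<rfloor>, \<lfloor>y / t\<rfloor> + 1}"
  have K0: "0 \<le> K" using K[of 0] norm_ge_zero order_trans by blast
  have synth1: "synth 1 c z = u z" for z unfolding synth_eq u_def by simp
  have uI: "u z = (\<Sum>m\<in>I. c m * of_real (phi m z))" if "{\<lfloor>z\<rfloor>, \<lfloor>z\<rfloor> + 1} \<subseteq> I" for z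
    unfolding synth1[symmetric] using that by (subst synth_eq_sum[of I]) (auto simp: I_def)
  have ux: "cmod (u (x / s)) \<le> K"
    using cmod_synth_le[of c K, OF K, of 1 "x / s"] by (simp add: synth1)
  \<comment> \<open>The four listed nodes may coincide, so only an upper bound on the cardinality is
    available.\<close>
  have card: "real (card I) \<le> 4"
    unfolding I_def using card_insert_le_m1 card_length[of "[\<lfloor>x / s\<rfloor>, \<lfloor>x / s\<rfloor> + 1, \<lfloor>y / t\<rfloor>, \<lfloor>y / t\<rfloor> + 1]"] by simp
  have "u (x / s) - u (y / t) = (\<Sum>m\<in>I. c m * of_real (phi m (x / s) - phi m (y / t)))"
    by (simp add: uI I_def sum_subtractf right_diff_distrib)
  also have "cmod \<dots> \<le> (\<Sum>m\<in>I. K * \<bar>x / s - y / t\<bar>)"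
  proof (rule sum_norm_le)
    fix m
    have "\<bar>phi m (x / s) - phi m (y / t)\<bar> \<le> \<bar>x / s - y / t\<bar>"
      using phi0_lipschitz[of "x / s - of_int m" "y / t - of_int m"] by (simp add: phi_def)
    then show "cmod (c m * of_real (phi m (x / s) - phi m (y / t))) \<le> K * \<bar>x / s - y / t\<bar>"
      unfolding norm_mult norm_of_real using K K0 by (intro mult_mono) auto
  qed
  also have "\<dots> \<le> 4 * (K * \<bar>x / s - y / t\<bar>)"
    using card K0 by (simp add: mult_right_mono)
  finally have lip: "cmod (u (x / s) - u (y / t)) \<le> 4 * (K * \<bar>x / s - y / t\<bar>)" .
  have "synth s c x - synth t c y = of_real (s powr (-1/2) - t powr (-1/2)) * u (x / s)
      + of_real (t powr (-1/2)) * (u (x / s) - u (y / t))"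
    by (simp add: synth_eq u_def algebra_simps)
  also have "cmod \<dots> \<le> \<bar>s powr (-1/2) - t powr (-1/2)\<bar> * cmod (u (x / s))
      + t powr (-1/2) * cmod (u (x / s) - u (y / t))"
    by (rule norm_triangle_le) (simp only: norm_mult norm_of_real, simp)
  also have "\<dots> \<le> \<bar>s powr (-1/2) - t powr (-1/2)\<bar> * K + t powr (-1/2) * (4 * (K * \<bar>x / s - y / t\<bar>))"
    by (intro add_mono mult_left_mono ux lip) auto
  finally show ?thesis by (simp add: algebra_simps)
qed

lemma continuous_synth:
  assumes K: "\<And>m. cmod (c m) \<le> K"
  shows "continuous_on UNIV (synth t c)"
proof (rule lipschitz_on_continuous_on)
  show "(t powr (-1/2) * 4 * K * \<bar>1 / t\<bar>)-lipschitz_on UNIV (synth t c)"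
  proof (rule lipschitz_onI)
    fix x y
    have "\<bar>x / t - y / t\<bar> = \<bar>1 / t\<bar> * \<bar>x - y\<bar>"
      by (simp add: diff_divide_distrib[symmetric] abs_divide)
    then show "dist (synth t c x) (synth t c y) \<le> t powr (-1/2) * 4 * K * \<bar>1 / t\<bar> * dist x y"
      using synth_diff_le[of c K, OF K, of t x t y] by (simp add: dist_norm mult_ac)
    have "0 \<le> K" using K[of 0] norm_ge_zero order_trans by blast
    then show "0 \<le> t powr (-1/2) * 4 * K * \<bar>1 / t\<bar>" by simp
  qed
qed

lemma measurable_synth: "l2_le c B \<Longrightarrow> synth t c \<in> borel_measurable borel"
  by (intro borel_measurable_continuous_onI continuous_synth[of c "sqrt B"] l2_le_cmod)

text \<open>Node \<open>m\<close> contributes at most the squared modulus of \<open>c m\<close>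
  divided by \<open>t\<close>, on an interval of length \<open>2 * t\<close> centred at
  \<open>t * m\<close>. Integration cancels \<open>t\<close>, so the bound is uniform in the
  scale.\<close>

lemma l2sq_synth_le:
  assumes t: "t > 0" and c: "l2_le c B"
  shows "l2sq (synth t c) \<le> ennreal (2 * B)"
proof -
  \<comment> \<open>Enumerating the integers by the naturals lets the nonnegative integral be
    exchanged with a countable sum.\<close>
  define d where "d i = int_decode i" for i
  have injd: "inj_on d A" for A unfolding d_def by (metis inj_int_decode inj_on_subset subset_UNIV)
  define h :: "nat \<Rightarrow> real \<Rightarrow> ennreal" where
    "h i x = ennreal ((cmod (c (d i)))\<^sup>2 / t) * indicator {t * (d i - 1)..t * (d i + 1)} x" for i x
  have pt: "ennreal ((cmod (synth t c x))\<^sup>2) \<le> (\<Sum>i. h i x)" for x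
  proof -
    let ?k = "\<lfloor>x / t\<rfloor>"
    let ?I = "{int_encode ?k, int_encode (?k + 1)}"
    have k: "of_int ?k \<le> x / t" "x / t \<le> of_int ?k + 1" by linarith+
    have k': "t * of_int ?k \<le> x" "x \<le> t * (of_int ?k + 1)"
      using t mult_left_mono[OF k(1), of t] mult_left_mono[OF k(2), of t] by simp_all
    then have k'': "t * (of_int ?k - 1) \<le> x" "x \<le> t * (of_int ?k + 2)"
      using t by (simp_all add: algebra_simps)
    have "ennreal ((cmod (synth t c x))\<^sup>2) \<le> ennreal ((cmod (c ?k))\<^sup>2 / t + (cmod (c (?k + 1)))\<^sup>2 / t)"
      by (intro ennreal_leI cmod_synth_sq_le t)
    also have "\<dots> = ennreal ((cmod (c ?k))\<^sup>2 / t) + ennreal ((cmod (c (?k + 1)))\<^sup>2 / t)"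
      using t by (intro ennreal_plus) auto
    also have "\<dots> = (\<Sum>i\<in>?I. h i x)"
    proof -
      have "h (int_encode ?k) x = ennreal ((cmod (c ?k))\<^sup>2 / t)"
        using k' k'' by (simp add: h_def d_def indicator_def)
      moreover have "h (int_encode (?k + 1)) x = ennreal ((cmod (c (?k + 1)))\<^sup>2 / t)"
        using k' k'' by (simp add: h_def d_def indicator_def add.commute)
      moreover have "int_encode ?k \<noteq> int_encode (?k + 1)" by (simp add: int_encode_eq)
      ultimately show ?thesis by simp
    qed
    also have "\<dots> \<le> (\<Sum>i. h i x)"
      by (rule sum_le_suminf) auto
    finally show ?thesis .
  qed
  have meas [measurable]: "h i \<in> borel_measurable lborel" for i
    unfolding h_def by measurable
  have int: "integral\<^sup>N lborel (h i) = ennreal (2 * (cmod (c (d i)))\<^sup>2)" for i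
  proof -
    have "integral\<^sup>N lborel (h i) = ennreal ((cmod (c (d i)))\<^sup>2 / t) * ennreal (t * (d i + 1) - t * (d i - 1))"
      unfolding h_def using t by (subst nn_integral_cmult_indicator) (auto simp: mult_left_mono)
    also have "t * (d i + 1) - t * (d i - 1) = 2 * t" by (simp add: algebra_simps)
    also have "ennreal ((cmod (c (d i)))\<^sup>2 / t) * ennreal (2 * t) = ennreal ((cmod (c (d i)))\<^sup>2 / t * (2 * t))"
      using t by (intro ennreal_mult[symmetric]) auto
    finally show ?thesis using t by (simp add: mult.commute)
  qed
  have "l2sq (synth t c) \<le> (\<integral>\<^sup>+x. (\<Sum>i. h i x) \<partial>lborel)"
    unfolding l2sq_def by (intro nn_integral_mono pt)
  also have "\<dots> = (\<Sum>i. integral\<^sup>N lborel (h i))"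
    by (rule nn_integral_suminf) simp
  also have "\<dots> \<le> ennreal (2 * B)"
  proof (rule suminf_le_const)
    fix n
    have "(\<Sum>i<n. integral\<^sup>N lborel (h i)) = ennreal (2 * (\<Sum>i<n. (cmod (c (d i)))\<^sup>2))"
      unfolding int by (subst sum_ennreal) (auto simp: sum_distrib_left)
    also have "(\<Sum>i<n. (cmod (c (d i)))\<^sup>2) = (\<Sum>m\<in>d ` {..<n}. (cmod (c m))\<^sup>2)"
      by (simp add: sum.reindex[OF injd])
    also have "ennreal (2 * (\<Sum>m\<in>d ` {..<n}. (cmod (c m))\<^sup>2)) \<le> ennreal (2 * B)"
      using c unfolding l2_le_def by (intro ennreal_leI mult_left_mono) auto
    finally show "(\<Sum>i<n. integral\<^sup>N lborel (h i)) \<le> ennreal (2 * B)" .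
  qed simp
  finally show ?thesis .
qed

lemma sqint_iff: "u \<in> borel_measurable lborel \<Longrightarrow> sqint u \<longleftrightarrow> l2sq u < \<infinity>"
  by (auto simp: sqint_def l2sq_def integrable_iff_bounded)

lemma sqint_synth: "t > 0 \<Longrightarrow> l2_le c B \<Longrightarrow> sqint (synth t c)"
  using l2sq_synth_le[of t c B] measurable_synth[of c B t]
  by (subst sqint_iff) (auto intro: le_less_trans)

section \<open>Convolution operators\<close>

lemma integrable_bounded_support:
  fixes f :: "real \<Rightarrow> 'a::{banach,second_countable_topology}"
  assumes f: "f \<in> borel_measurable lborel" and K: "AE x in lborel. norm (f x) \<le> K"
    and R: "\<And>x. R < \<bar>x\<bar> \<Longrightarrow> f x = 0"
  shows "integrable lborel f"
proof (rule Bochner_Integration.integrable_bound[OF _ f])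
  show "integrable lborel (\<lambda>x. K * indicator {-R..R} x :: real)"
    by (intro integrable_mult_right integrable_real_indicator) (auto simp: emeasure_lborel_Icc_eq)
  show "AE x in lborel. norm (f x) \<le> norm (K * indicator {-R..R} x)"
    using K
  proof eventually_elim
    case (elim x)
    then show ?case
      using R[of x] by (cases "R < \<bar>x\<bar>") (auto simp: indicator_def)
  qed
qed

lemma sqint_bounded_support:
  assumes f: "f \<in> borel_measurable lborel" and K: "AE x in lborel. cmod (f x) \<le> K"
    and R: "\<And>x. R < \<bar>x\<bar> \<Longrightarrow> f x = 0"
  shows "sqint f"
  unfolding sqint_def
proof
  show "integrable lborel (\<lambda>x. (cmod (f x))\<^sup>2)"
  proof (rule integrable_bounded_support[of _ "K\<^sup>2" R])
    show "AE x in lborel. norm ((cmod (f x))\<^sup>2) \<le> K\<^sup>2"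
      using K by eventually_elim (auto intro: power_mono)
  qed (use f R in auto)
qed (rule f)

lemma Linf0_E:
  assumes "Linf0 f"
  obtains R where "R > 0" "\<And>x. R < \<bar>x\<bar> \<Longrightarrow> f x = 0" "integrable lborel f" "sqint f"
proof -
  obtain K B where f: "f \<in> borel_measurable lborel" and K: "AE x in lborel. cmod (f x) \<le> K"
    and B: "bounded B" "\<And>x. x \<notin> B \<Longrightarrow> f x = 0"
    using assms unfolding Linf0_def by blast
  obtain R where R: "R > 0" "\<And>x. x \<in> B \<Longrightarrow> \<bar>x\<bar> \<le> R"
    using B(1) unfolding bounded_pos by auto
  have z: "f x = 0" if "R < \<bar>x\<bar>" for x
    using that R(2)[of x] B(2)[of x] by fastforce
  show thesis
    by (rule that[OF R(1) z integrable_bounded_support[OF f K z] sqint_bounded_support[OF f K z]])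
qed

lemma Cc_Linf0: "Cc g \<Longrightarrow> Linf0 g"
proof -
  assume "Cc g"
  then obtain B where g: "continuous_on UNIV g" and B: "compact B" "\<And>x. x \<notin> B \<Longrightarrow> g x = 0"
    unfolding Cc_def by blast
  have "bounded (g ` B)"
    by (intro compact_imp_bounded compact_continuous_image continuous_on_subset[OF g] B) auto
  then obtain K where "K > 0" "\<And>x. x \<in> B \<Longrightarrow> cmod (g x) \<le> K"
    unfolding bounded_pos by auto
  then have "cmod (g x) \<le> K" for x
    using B(2)[of x] by (cases "x \<in> B") auto
  then have "AE x in lborel. cmod (g x) \<le> K" by simp
  moreover have "g \<in> borel_measurable lborel"
    using borel_measurable_continuous_onI[OF g] by simp
  ultimately show "Linf0 g"
    unfolding Linf0_def using B compact_imp_bounded by blast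
qed

section \<open>Convolution bounds and linearity of the generators\<close>

definition conv :: "(real \<Rightarrow> complex) \<Rightarrow> (real \<Rightarrow> complex) \<Rightarrow> real \<Rightarrow> complex" where
  "conv g u x = (LINT y|lborel. g y * u (x - y))"

lemma Sfg_eq: "Sfg f g u x = f x * conv g u x"
  by (simp add: Sfg_def conv_def)

lemma measurable_conv:
  assumes [measurable]: "g \<in> borel_measurable borel" "u \<in> borel_measurable borel"
  shows "conv g u \<in> borel_measurable borel"
  unfolding conv_def[abs_def] by measurable

lemma cmod_mult_le_sq: "cmod (a * b) \<le> (cmod a)\<^sup>2 + (cmod b)\<^sup>2"
proof -
  have "2 * cmod a * cmod b \<le> (cmod a)\<^sup>2 + (cmod b)\<^sup>2" by (rule sum_squares_bound)
  moreover have "0 \<le> cmod a * cmod b" by simp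
  ultimately show ?thesis unfolding norm_mult by linarith
qed

lemma integrable_mult_sqint:
  assumes "sqint u" "sqint v"
  shows "integrable lborel (\<lambda>x. u x * v x)"
proof (rule Bochner_Integration.integrable_bound)
  show "integrable lborel (\<lambda>x. (cmod (u x))\<^sup>2 + (cmod (v x))\<^sup>2)"
    using assms by (auto simp: sqint_def)
  show "(\<lambda>x. u x * v x) \<in> borel_measurable lborel"
    using assms by (auto simp: sqint_def)
qed (use cmod_mult_le_sq in auto)

lemma sqint_cnj: "sqint u \<Longrightarrow> sqint (\<lambda>x. cnj (u x))"
  unfolding sqint_def by (auto intro: borel_measurable_continuous_on[OF continuous_on_cnj[OF continuous_on_id]])

lemma
  assumes "sqint u"
  shows sqint_reflect: "sqint (\<lambda>y. u (x - y))"
    and integral_sq_reflect: "(LINT y|lborel. (cmod (u (x - y)))\<^sup>2) = (LINT y|lborel. (cmod (u y))\<^sup>2)"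
proof -
  have [measurable]: "u \<in> borel_measurable borel" using assms by (simp add: sqint_def)
  have "integrable lborel (\<lambda>y. (cmod (u (x + (-1) * y)))\<^sup>2)"
    using assms unfolding sqint_def by (intro lborel_integrable_real_affine[of "\<lambda>y. (cmod (u y))\<^sup>2"]) auto
  then show "sqint (\<lambda>y. u (x - y))" unfolding sqint_def by simp
  show "(LINT y|lborel. (cmod (u (x - y)))\<^sup>2) = (LINT y|lborel. (cmod (u y))\<^sup>2)"
    by (subst (2) lborel_integral_real_affine[of "-1" _ x]) auto
qed

lemma integrable_conv:
  assumes "sqint g" "sqint u"
  shows "integrable lborel (\<lambda>y. g y * u (x - y))"
  by (intro integrable_mult_sqint sqint_reflect assms)

text \<open>A crude bound, uniform in \<open>x\<close>; it dominates \<open>Sfg f g u\<close> by a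
  multiple of \<open>f\<close> and so yields square integrability.\<close>

lemma cmod_conv_le:
  assumes g: "sqint g" and u: "sqint u"
  shows "cmod (conv g u x) \<le> (LINT y|lborel. (cmod (g y))\<^sup>2) + (LINT y|lborel. (cmod (u y))\<^sup>2)"
proof -
  have "cmod (conv g u x) \<le> (LINT y|lborel. cmod (g y * u (x - y)))"
    unfolding conv_def by (rule integral_norm_bound)
  also have "\<dots> \<le> (LINT y|lborel. (cmod (g y))\<^sup>2 + (cmod (u (x - y)))\<^sup>2)"
    using g sqint_reflect[OF u] by (intro integral_mono' cmod_mult_le_sq) (auto simp: sqint_def)
  also have "\<dots> = (LINT y|lborel. (cmod (g y))\<^sup>2) + (LINT y|lborel. (cmod (u (x - y)))\<^sup>2)"
    using g sqint_reflect[OF u] by (intro Bochner_Integration.integral_add) (auto simp: sqint_def)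
  finally show ?thesis by (simp add: integral_sq_reflect[OF u])
qed

lemma sqint_Sfg:
  assumes f: "Linf0 f" and g: "Cc g" and u: "sqint u"
  shows "sqint (Sfg f g u)"
proof -
  have sf: "sqint f" using Linf0_E[OF f] by metis
  have sg: "sqint g" using Linf0_E[OF Cc_Linf0[OF g]] by metis
  define A where "A = (LINT y|lborel. (cmod (g y))\<^sup>2) + (LINT y|lborel. (cmod (u y))\<^sup>2)"
  have m: "(\<lambda>x. f x * conv g u x) \<in> borel_measurable lborel"
    using sf sg u measurable_conv[of g u] by (auto simp: sqint_def)
  have "integrable lborel (\<lambda>x. (cmod (f x * conv g u x))\<^sup>2)"
  proof (rule Bochner_Integration.integrable_bound)
    show "integrable lborel (\<lambda>x. A\<^sup>2 * (cmod (f x))\<^sup>2)"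
      using sf by (simp add: sqint_def)
    have "(cmod (f x * conv g u x))\<^sup>2 \<le> A\<^sup>2 * (cmod (f x))\<^sup>2" for x
      unfolding norm_mult power_mult_distrib mult.commute[of "A\<^sup>2"]
      by (intro mult_left_mono power_mono) (auto simp: A_def cmod_conv_le[OF sg u])
    then show "AE x in lborel. norm ((cmod (f x * conv g u x))\<^sup>2) \<le> norm (A\<^sup>2 * (cmod (f x))\<^sup>2)"
      by simp
  qed (use m in measurable)
  then show ?thesis using m unfolding sqint_def Sfg_eq[abs_def] by simp
qed

lemma Sfg_sum:
  assumes g: "Cc g" and u: "\<And>m. m \<in> F \<Longrightarrow> sqint (u m)"
  shows "Sfg f g (\<lambda>x. \<Sum>m\<in>F. a m * u m x) x = (\<Sum>m\<in>F. a m * Sfg f g (u m) x)"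
proof -
  have sg: "sqint g" using Linf0_E[OF Cc_Linf0[OF g]] by metis
  have "conv g (\<lambda>x. \<Sum>m\<in>F. a m * u m x) x = (LINT y|lborel. (\<Sum>m\<in>F. a m * (g y * u m (x - y))))"
    unfolding conv_def by (simp add: sum_distrib_left mult_ac)
  also have "\<dots> = (\<Sum>m\<in>F. a m * conv g (u m) x)"
    unfolding conv_def using integrable_conv[OF sg u]
    by (subst Bochner_Integration.integral_sum) (auto intro: sum.cong)
  finally show ?thesis by (simp add: Sfg_eq sum_distrib_left mult_ac)
qed

text \<open>With \<open>x\<close> and the support of \<open>g\<close> within radius
  \<open>R\<close>, the argument \<open>x - y\<close> stays within \<open>2 * R\<close>, so control
  of \<open>u\<close> on that compact interval suffices.\<close>

lemma cmod_conv_le_sup: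
  assumes g: "integrable lborel g" "\<And>y. R < \<bar>y\<bar> \<Longrightarrow> g y = 0"
    and u: "\<And>z. \<bar>z\<bar> \<le> 2 * R \<Longrightarrow> cmod (u z) \<le> M" and x: "\<bar>x\<bar> \<le> R" and M: "0 \<le> M"
  shows "cmod (conv g u x) \<le> M * (LINT y|lborel. cmod (g y))"
proof -
  have "cmod (conv g u x) \<le> (LINT y|lborel. cmod (g y * u (x - y)))"
    unfolding conv_def by (rule integral_norm_bound)
  also have "\<dots> \<le> (LINT y|lborel. M * cmod (g y))"
  proof (rule integral_mono')
    fix y
    show "cmod (g y * u (x - y)) \<le> M * cmod (g y)"
    proof (cases "R < \<bar>y\<bar>")
      case False
      then have "cmod (u (x - y)) \<le> M" using x by (intro u) auto
      then have "cmod (u (x - y)) * cmod (g y) \<le> M * cmod (g y)"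
        by (rule mult_right_mono) simp
      then show ?thesis by (simp add: norm_mult mult.commute)
    qed (simp add: g(2))
  qed (use g M in auto)
  finally show ?thesis by simp
qed

section \<open>Dependence on the scale for a single generator\<close>

text \<open>The difference splits as in the product rule: one part carries \<open>vs - vt\<close>,
  the other \<open>us - ut\<close>. Each contributes \<open>M * e\<close> times the two integrals,
  because \<open>f\<close> confines the outer variable to radius \<open>R\<close>.\<close>

lemma Sfg_form_diff_le:
  assumes f: "integrable lborel f" "\<And>x. R < \<bar>x\<bar> \<Longrightarrow> f x = 0" "Linf0 f"
    and g: "integrable lborel g" "\<And>x. R < \<bar>x\<bar> \<Longrightarrow> g x = 0" "Cc g"
    and s: "sqint us" "sqint ut" "sqint vs" "sqint vt"
    and M: "\<And>z. cmod (us z) \<le> M" "\<And>z. cmod (vt z) \<le> M"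
    and e: "\<And>z. \<bar>z\<bar> \<le> 2 * R \<Longrightarrow> cmod (us z - ut z) \<le> e" "\<And>z. \<bar>z\<bar> \<le> 2 * R \<Longrightarrow> cmod (vs z - vt z) \<le> e"
    and R: "0 < R"
  shows "cmod ((LINT x|lborel. cnj (vs x) * Sfg f g us x) - (LINT x|lborel. cnj (vt x) * Sfg f g ut x))
     \<le> 2 * M * e * (LINT x|lborel. cmod (f x)) * (LINT x|lborel. cmod (g x))"
proof -
  let ?g = "LINT x|lborel. cmod (g x)"
  have sg: "sqint g" using Linf0_E[OF Cc_Linf0[OF g(3)]] by metis
  have M0: "0 \<le> M" using M(1)[of 0] norm_ge_zero order_trans by blast
  have e0: "0 \<le> e" using order_trans[OF norm_ge_zero e(1)[of 0]] R by simp
  have g0: "0 \<le> ?g" by simp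
  have int: "integrable lborel (\<lambda>x. cnj (v x) * Sfg f g u x)" if "sqint u" "sqint v" for u v
    by (intro integrable_mult_sqint sqint_cnj sqint_Sfg f g that)
  have "(LINT x|lborel. cnj (vs x) * Sfg f g us x) - (LINT x|lborel. cnj (vt x) * Sfg f g ut x)
     = (LINT x|lborel. cnj (vs x) * Sfg f g us x - cnj (vt x) * Sfg f g ut x)"
    by (rule Bochner_Integration.integral_diff[symmetric]) (intro int s)+
  also have "cmod \<dots> \<le> (LINT x|lborel. cmod (cnj (vs x) * Sfg f g us x - cnj (vt x) * Sfg f g ut x))"
    by (rule integral_norm_bound)
  also have "\<dots> \<le> (LINT x|lborel. 2 * M * e * ?g * cmod (f x))"
  proof (rule integral_mono')
    fix x
    show "cmod (cnj (vs x) * Sfg f g us x - cnj (vt x) * Sfg f g ut x) \<le> 2 * M * e * ?g * cmod (f x)"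
    proof (cases "R < \<bar>x\<bar>")
      case False
      then have x: "\<bar>x\<bar> \<le> R" by simp
      have "conv g us x - conv g ut x = conv g (\<lambda>z. us z - ut z) x"
        unfolding conv_def right_diff_distrib
        by (rule Bochner_Integration.integral_diff[symmetric]) (intro integrable_conv sg s)+
      then have c1: "cmod (conv g us x - conv g ut x) \<le> e * ?g"
        using cmod_conv_le_sup[OF g(1,2) e(1) x e0] by simp
      have c2: "cmod (conv g us x) \<le> M * ?g"
        by (rule cmod_conv_le_sup[OF g(1,2) M(1) x M0])
      have c3: "cmod (cnj (vs x - vt x)) \<le> e"
        using e(2)[of x] x R by (simp only: complex_mod_cnj)
      have "cnj (vs x) * Sfg f g us x - cnj (vt x) * Sfg f g ut x
        = (cnj (vs x - vt x) * conv g us x + cnj (vt x) * (conv g us x - conv g ut x)) * f x"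
        by (simp add: Sfg_eq algebra_simps)
      also have "cmod \<dots> \<le> (e * (M * ?g) + M * (e * ?g)) * cmod (f x)"
        unfolding norm_mult
      proof (intro mult_right_mono norm_triangle_mono)
        show "cmod (cnj (vs x - vt x) * conv g us x) \<le> e * (M * ?g)"
          unfolding norm_mult by (intro mult_mono c2 c3 e0) simp
        show "cmod (cnj (vt x) * (conv g us x - conv g ut x)) \<le> M * (e * ?g)"
          unfolding norm_mult complex_mod_cnj by (intro mult_mono c1 M M0) simp
      qed simp
      finally show ?thesis by (simp add: algebra_simps)
    qed (simp add: Sfg_eq f(2))
  next
    show "integrable lborel (\<lambda>x. 2 * M * e * ?g * cmod (f x))" using f(1) by simp
    show "0 \<le> 2 * M * e * ?g * cmod (f x)" for x using M0 e0 g0 by (simp add: mult_nonneg_nonneg)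
  qed
  finally show ?thesis by (simp add: mult_ac)
qed

text \<open>The neighbourhood is fixed before \<open>c\<close> and \<open>d\<close> are given. This
  uniformity over bounded coefficient vectors is what turns continuity of single entries into norm
  continuity.\<close>

lemma Sfg_form_continuous:
  assumes f: "Linf0 f" and g: "Cc g" and t: "t > 0" and \<epsilon>: "\<epsilon> > 0"
  shows "\<forall>\<^sub>F s in nhds t. \<forall>c d. l2_le c B \<longrightarrow> l2_le d B \<longrightarrow>
     cmod ((LINT x|lborel. cnj (synth s d x) * Sfg f g (synth s c) x)
        - (LINT x|lborel. cnj (synth t d x) * Sfg f g (synth t c) x)) < \<epsilon>"
proof -
  obtain R1 where R1: "R1 > 0" "\<And>x. R1 < \<bar>x\<bar> \<Longrightarrow> f x = 0" "integrable lborel f"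
    using Linf0_E[OF f] by metis
  obtain R2 where R2: "R2 > 0" "\<And>x. R2 < \<bar>x\<bar> \<Longrightarrow> g x = 0" "integrable lborel g"
    using Linf0_E[OF Cc_Linf0[OF g]] by metis
  define R where "R = max R1 R2"
  define K where "K = sqrt B"
  \<comment> \<open>\<open>\<eta> s\<close> is the bound of \<open>synth_diff_le\<close> at equal
    points of modulus at most \<open>2 * R\<close>; it vanishes at \<open>s = t\<close>.\<close>
  define \<eta> where "\<eta> s = K * (\<bar>s powr (-1/2) - t powr (-1/2)\<bar> + t powr (-1/2) * 4 * (2 * R * \<bar>1 / s - 1 / t\<bar>))" for s
  define M where "M s = max (s powr (-1/2)) (t powr (-1/2)) * K" for s
  let ?Q = "\<lambda>s. 2 * M s * \<eta> s * (LINT x|lborel. cmod (f x)) * (LINT x|lborel. cmod (g x))"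
  have "(?Q \<longlongrightarrow> 2 * M t * \<eta> t * (LINT x|lborel. cmod (f x)) * (LINT x|lborel. cmod (g x))) (nhds t)"
    unfolding M_def \<eta>_def using t by (intro tendsto_intros filterlim_ident) auto
  then have "(?Q \<longlongrightarrow> 0) (nhds t)" by (simp add: \<eta>_def)
  then have "\<forall>\<^sub>F s in nhds t. ?Q s < \<epsilon>"
    using \<epsilon> by (rule order_tendstoD)
  moreover have "\<forall>\<^sub>F s in nhds t. s > 0"
    using t eventually_nhds_in_open[of "{0<..}" t] by simp
  ultimately show ?thesis
  proof eventually_elim
    case (elim s)
    show ?case
    proof (intro allI impI)
      fix c d assume c: "l2_le c B" and d: "l2_le d B"
      have bnd: "cmod (synth r a z) \<le> M s" if "l2_le a B" "r = s \<or> r = t" for r a z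
      proof -
        have "0 \<le> K" using l2_le_nonneg[OF that(1)] by (simp add: K_def)
        then have "r powr (-1/2) * K \<le> M s"
          unfolding M_def using that(2) by (intro mult_right_mono) auto
        then show ?thesis
          using cmod_synth_le[of a K r z] l2_le_cmod[OF that(1)] unfolding K_def[symmetric] by simp
      qed
      have close: "cmod (synth s a z - synth t a z) \<le> \<eta> s" if a: "l2_le a B" and z: "\<bar>z\<bar> \<le> 2 * R" for a z
      proof -
        have "0 \<le> K" using l2_le_nonneg[OF a] by (simp add: K_def)
        have "\<bar>z / s - z / t\<bar> = \<bar>z\<bar> * \<bar>1 / s - 1 / t\<bar>"
          by (simp add: abs_mult[symmetric] right_diff_distrib)
        also have "\<dots> \<le> 2 * R * \<bar>1 / s - 1 / t\<bar>" using z by (intro mult_right_mono) auto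
        finally have zz: "\<bar>z / s - z / t\<bar> \<le> 2 * R * \<bar>1 / s - 1 / t\<bar>" .
        have "cmod (synth s a z - synth t a z)
           \<le> K * (\<bar>s powr (-1/2) - t powr (-1/2)\<bar> + t powr (-1/2) * 4 * \<bar>z / s - z / t\<bar>)"
          by (rule synth_diff_le) (simp add: K_def l2_le_cmod[OF a])
        also have "\<dots> \<le> \<eta> s"
          unfolding \<eta>_def using zz \<open>0 \<le> K\<close> by (intro mult_left_mono add_left_mono) auto
        finally show ?thesis .
      qed
      have "cmod ((LINT x|lborel. cnj (synth s d x) * Sfg f g (synth s c) x)
        - (LINT x|lborel. cnj (synth t d x) * Sfg f g (synth t c) x)) \<le> ?Q s"
        by (rule Sfg_form_diff_le[OF R1(3) _ f R2(3) _ g, of R])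
           (use elim(2) t c d R1 R2 in \<open>auto intro: sqint_synth bnd close simp: R_def\<close>)
      then show "cmod ((LINT x|lborel. cnj (synth s d x) * Sfg f g (synth s c) x)
        - (LINT x|lborel. cnj (synth t d x) * Sfg f g (synth t c) x)) < \<epsilon>"
        using elim(1) by linarith
    qed
  qed
qed

section \<open>Approximation in operator norm\<close>

text \<open>Real-valued counterpart of \<open>l2sq\<close>, meant for use under
  \<open>sqint\<close>: the Bochner integral is 0 when the square is not integrable.\<close>

definition l2int :: "(real \<Rightarrow> complex) \<Rightarrow> real" where
  "l2int u = (LINT x|lborel. (cmod (u x))\<^sup>2)"

lemma l2int_nonneg [simp]: "0 \<le> l2int u"
  by (simp add: l2int_def)

lemma l2sq_eq_l2int: "sqint u \<Longrightarrow> l2sq u = ennreal (l2int u)"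
  unfolding l2sq_def l2int_def by (rule nn_integral_eq_integral) (auto simp: sqint_def)

lemma cmod_add_sq_le: "(cmod (a + b))\<^sup>2 \<le> 2 * (cmod a)\<^sup>2 + 2 * (cmod b)\<^sup>2"
proof -
  have "(cmod (a + b))\<^sup>2 \<le> (cmod a + cmod b)\<^sup>2"
    by (intro power_mono norm_triangle_ineq) simp
  also have "\<dots> \<le> 2 * (cmod a)\<^sup>2 + 2 * (cmod b)\<^sup>2"
    using sum_squares_bound[of "cmod a" "cmod b"] by (simp add: power2_sum)
  finally show ?thesis .
qed

lemma
  assumes "sqint u" "sqint v"
  shows sqint_add: "sqint (\<lambda>x. u x + v x)"
    and l2int_add_le: "l2int (\<lambda>x. u x + v x) \<le> 2 * l2int u + 2 * l2int v"
proof -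
  have i: "integrable lborel (\<lambda>x. 2 * (cmod (u x))\<^sup>2 + 2 * (cmod (v x))\<^sup>2)"
    using assms by (auto simp: sqint_def)
  have [measurable]: "u \<in> borel_measurable lborel" "v \<in> borel_measurable lborel"
    using assms by (auto simp: sqint_def)
  have "integrable lborel (\<lambda>x. (cmod (u x + v x))\<^sup>2)"
    by (rule Bochner_Integration.integrable_bound[OF i]) (auto simp: cmod_add_sq_le)
  then show "sqint (\<lambda>x. u x + v x)"
    unfolding sqint_def by auto
  have "l2int (\<lambda>x. u x + v x) \<le> (LINT x|lborel. 2 * (cmod (u x))\<^sup>2 + 2 * (cmod (v x))\<^sup>2)"
    unfolding l2int_def by (rule integral_mono'[OF i]) (auto simp: cmod_add_sq_le)
  also have "\<dots> = 2 * l2int u + 2 * l2int v"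
    using assms unfolding l2int_def by (subst Bochner_Integration.integral_add) (auto simp: sqint_def)
  finally show "l2int (\<lambda>x. u x + v x) \<le> 2 * l2int u + 2 * l2int v" .
qed

lemma sqint_cmult: "sqint u \<Longrightarrow> sqint (\<lambda>x. a * u x)"
  by (auto simp: sqint_def norm_mult power_mult_distrib)

lemma l2int_cmult: "l2int (\<lambda>x. a * u x) = (cmod a)\<^sup>2 * l2int u"
  by (simp add: l2int_def norm_mult power_mult_distrib)

lemma sqint_diff: "sqint u \<Longrightarrow> sqint v \<Longrightarrow> sqint (\<lambda>x. u x - v x)"
  using sqint_add[of u "\<lambda>x. -1 * v x"] sqint_cmult[of v "-1"] by simp

lemma l2int_diff_commute: "l2int (\<lambda>x. u x - v x) = l2int (\<lambda>x. v x - u x)"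
  by (simp add: l2int_def norm_minus_commute)

lemma sqint_zero: "sqint (\<lambda>x. 0)"
  by (simp add: sqint_def)

lemma sqint_sum: "(\<And>i. i \<in> I \<Longrightarrow> sqint (u i)) \<Longrightarrow> sqint (\<lambda>x. \<Sum>i\<in>I. u i x)"
  by (induction I rule: infinite_finite_induct) (auto intro: sqint_add simp: sqint_zero)

lemma l2int_sum_le:
  assumes u: "\<And>i. i \<in> I \<Longrightarrow> sqint (u i)"
  shows "l2int (\<lambda>x. \<Sum>i\<in>I. u i x) \<le> card I * (\<Sum>i\<in>I. l2int (u i))"
proof -
  have i: "integrable lborel (\<lambda>x. (\<Sum>i\<in>I. (cmod (u i x))\<^sup>2) * card I)"
    using u by (intro integrable_mult_left Bochner_Integration.integrable_sum) (auto simp: sqint_def)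
  have "l2int (\<lambda>x. \<Sum>i\<in>I. u i x) \<le> (LINT x|lborel. (\<Sum>i\<in>I. (cmod (u i x))\<^sup>2) * card I)"
    unfolding l2int_def
  proof (rule integral_mono'[OF i])
    fix x
    have "(cmod (\<Sum>i\<in>I. u i x))\<^sup>2 \<le> (\<Sum>i\<in>I. cmod (u i x))\<^sup>2"
      by (intro power_mono norm_sum) simp
    also have "\<dots> \<le> (\<Sum>i\<in>I. (cmod (u i x))\<^sup>2) * card I"
      by (rule sum_squared_le_sum_of_squares)
    finally show "(cmod (\<Sum>i\<in>I. u i x))\<^sup>2 \<le> (\<Sum>i\<in>I. (cmod (u i x))\<^sup>2) * card I" .
  qed (simp add: sum_nonneg)
  also have "\<dots> = card I * (\<Sum>i\<in>I. l2int (u i))"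
    using u unfolding l2int_def by (simp add: sqint_def)
  finally show ?thesis .
qed

text \<open>A weighted arithmetic-geometric mean inequality in place of Cauchy-Schwarz; choosing
  \<open>l\<close> suitably recovers the product of norms without square roots.\<close>

lemma cmod_pairing_le:
  assumes v: "sqint v" and w: "sqint w" and l: "l > 0"
  shows "cmod (LINT x|lborel. cnj (v x) * w x) \<le> (l * l2int v + l2int w / l) / 2"
proof -
  have i: "integrable lborel (\<lambda>x. (l * (cmod (v x))\<^sup>2 + (cmod (w x))\<^sup>2 / l) / 2)"
    using v w by (auto simp: sqint_def)
  have "cmod (LINT x|lborel. cnj (v x) * w x) \<le> (LINT x|lborel. cmod (cnj (v x) * w x))"
    by (rule integral_norm_bound)
  also have "\<dots> \<le> (LINT x|lborel. (l * (cmod (v x))\<^sup>2 + (cmod (w x))\<^sup>2 / l) / 2)"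
  proof (rule integral_mono'[OF i])
    fix x
    have "2 * (l * cmod (v x)) * cmod (w x) \<le> (l * cmod (v x))\<^sup>2 + (cmod (w x))\<^sup>2"
      by (rule sum_squares_bound)
    then show "cmod (cnj (v x) * w x) \<le> (l * (cmod (v x))\<^sup>2 + (cmod (w x))\<^sup>2 / l) / 2"
      using l by (simp add: norm_mult field_simps power2_eq_square)
  qed (use l in simp)
  also have "\<dots> = (l * l2int v + l2int w / l) / 2"
    using v w unfolding l2int_def by (simp add: sqint_def)
  finally show ?thesis .
qed

section \<open>Approximating S by finite combinations of generators\<close>

definition Sspan :: "nat \<Rightarrow> (nat \<Rightarrow> real \<Rightarrow> complex) \<Rightarrow> (nat \<Rightarrow> real \<Rightarrow> complex) \<Rightarrow>
    (real \<Rightarrow> complex) \<Rightarrow> real \<Rightarrow> complex" where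
  "Sspan k fs gs u x = (\<Sum>i<k. Sfg (fs i) (gs i) u x)"

lemma sqint_Sspan:
  assumes "\<forall>i<k. Linf0 (fs i) \<and> Cc (gs i)" "sqint u"
  shows "sqint (Sspan k fs gs u)"
  unfolding Sspan_def[abs_def] using assms by (intro sqint_sum sqint_Sfg) auto

lemma Sspan_sum:
  assumes "\<forall>i<k. Linf0 (fs i) \<and> Cc (gs i)" "\<And>m. m \<in> F \<Longrightarrow> sqint (u m)"
  shows "Sspan k fs gs (\<lambda>x. \<Sum>m\<in>F. a m * u m x) x = (\<Sum>m\<in>F. a m * Sspan k fs gs (u m) x)"
proof -
  have "Sspan k fs gs (\<lambda>x. \<Sum>m\<in>F. a m * u m x) x = (\<Sum>i<k. \<Sum>m\<in>F. a m * Sfg (fs i) (gs i) (u m) x)"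
    unfolding Sspan_def using assms by (intro sum.cong refl Sfg_sum) auto
  then show ?thesis unfolding Sspan_def by (subst (asm) sum.swap) (simp add: sum_distrib_left)
qed

text \<open>Square integrability of \<open>S u\<close> comes from adding the approximant back to the
  error, which \<open>inA0\<close> bounds by the norm of \<open>u\<close>.\<close>

lemma inA0_approx:
  assumes "inA0 S" "\<epsilon> > 0"
  obtains k fs gs where "\<forall>i<k. Linf0 (fs i) \<and> Cc (gs i)"
    "\<And>u. sqint u \<Longrightarrow> sqint (S u)"
    "\<And>u. sqint u \<Longrightarrow> l2int (\<lambda>x. S u x - Sspan k fs gs u x) \<le> \<epsilon>\<^sup>2 * l2int u"
proof -
  have meas: "\<And>u. sqint u \<Longrightarrow> S u \<in> borel_measurable lborel"
    using assms(1) by (simp add: inA0_def)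
  from assms obtain k fs gs where k: "\<forall>i<k. Linf0 (fs i) \<and> Cc (gs i)"
    and le: "\<And>u. sqint u \<Longrightarrow> l2sq (\<lambda>x. S u x - Sspan k fs gs u x) \<le> ennreal (\<epsilon>\<^sup>2) * l2sq u"
    unfolding inA0_def Sspan_def by blast
  have sq: "sqint (\<lambda>x. S u x - Sspan k fs gs u x)" if u: "sqint u" for u
  proof (subst sqint_iff)
    show "(\<lambda>x. S u x - Sspan k fs gs u x) \<in> borel_measurable lborel"
      using meas[OF u] sqint_Sspan[OF k u] by (auto simp: sqint_def)
    show "l2sq (\<lambda>x. S u x - Sspan k fs gs u x) < \<infinity>"
      using le[OF u] l2sq_eq_l2int[OF u] by (auto simp: ennreal_mult[symmetric] intro: le_less_trans)
  qed
  have S: "sqint (S u)" if u: "sqint u" for u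
    using sqint_add[OF sq[OF u] sqint_Sspan[OF k u]] by simp
  have "l2int (\<lambda>x. S u x - Sspan k fs gs u x) \<le> \<epsilon>\<^sup>2 * l2int u" if u: "sqint u" for u
    using le[OF u] l2sq_eq_l2int[OF u] l2sq_eq_l2int[OF sq[OF u]]
    by (simp add: ennreal_mult[symmetric])
  then show thesis using that k S by blast
qed

text \<open>The operator in \<^const>\<open>inA0\<close> is linear only up to null sets. A second, finer approximant
  absorbs the resulting discrepancy.\<close>

lemma l2int_approx_error_le:
  assumes S: "inA0 S" and \<epsilon>: "\<epsilon> > 0"
    and k: "\<forall>i<k. Linf0 (fs i) \<and> Cc (gs i)"
    and le: "\<And>u. sqint u \<Longrightarrow> l2int (\<lambda>x. S u x - Sspan k fs gs u x) \<le> \<epsilon>\<^sup>2 * l2int u"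
    and p: "\<And>m. m \<in> F \<Longrightarrow> sqint (p m)" "\<And>m. m \<in> F \<Longrightarrow> l2int (p m) \<le> V"
    and a: "(\<Sum>m\<in>F. (cmod (a m))\<^sup>2) \<le> 1" and V: "l2int (\<lambda>x. \<Sum>m\<in>F. a m * p m x) \<le> V"
  shows "l2int (\<lambda>x. \<Sum>m\<in>F. a m * (S (p m) x - Sspan k fs gs (p m) x)) \<le> 16 * \<epsilon>\<^sup>2 * V"
proof -
  define u where "u = (\<lambda>x. \<Sum>m\<in>F. a m * p m x)"
  have u: "sqint u" unfolding u_def by (intro sqint_sum sqint_cmult p)
  have V0: "0 \<le> V" using V l2int_nonneg order_trans by blast
  \<comment> \<open>The finer tolerance absorbs the factor \<open>card F\<close> that
    \<open>l2int_sum_le\<close> costs; the \<open>+ 1\<close> covers empty \<open>F\<close>.\<close>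
  define \<eta> where "\<eta> = \<epsilon> / sqrt (card F + 1)"
  have \<eta>: "\<eta> > 0" using \<epsilon> by (simp add: \<eta>_def)
  have \<eta>sq: "\<eta>\<^sup>2 * (card F + 1) = \<epsilon>\<^sup>2"
    by (simp add: \<eta>_def power_divide)
  have \<eta>1: "\<eta>\<^sup>2 * card F \<le> \<epsilon>\<^sup>2" and \<eta>2: "\<eta>\<^sup>2 \<le> \<epsilon>\<^sup>2"
    unfolding \<eta>sq[symmetric] by (simp_all add: distrib_left)
  obtain k' fs' gs' where k': "\<forall>i<k'. Linf0 (fs' i) \<and> Cc (gs' i)"
    and SS: "\<And>u. sqint u \<Longrightarrow> sqint (S u)"
    and le': "\<And>u. sqint u \<Longrightarrow> l2int (\<lambda>x. S u x - Sspan k' fs' gs' u x) \<le> \<eta>\<^sup>2 * l2int u"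
    using inA0_approx[OF S \<eta>] by metis
  \<comment> \<open>The error telescopes through the finer approximant at \<open>u\<close> and
    through \<open>S u\<close>: \<open>A\<close> is the fine error on the individual vectors,
    \<open>B\<close> the fine error on their combination, \<open>C\<close> the coarse error there.
    Linearity enters through the approximants, where it holds exactly.\<close>
  define A where "A x = (\<Sum>m\<in>F. a m * (S (p m) x - Sspan k' fs' gs' (p m) x))" for x
  define B where "B x = Sspan k' fs' gs' u x - S u x" for x
  define C where "C x = S u x - Sspan k fs gs u x" for x
  have sq': "sqint (\<lambda>x. S v x - Sspan k' fs' gs' v x)" if "sqint v" for v
    by (intro sqint_diff SS sqint_Sspan[OF k'] that)
  have sA: "sqint A" unfolding A_def[abs_def] by (intro sqint_sum sqint_cmult sq' p)
  have sB: "sqint B" unfolding B_def[abs_def] by (intro sqint_diff SS sqint_Sspan[OF k'] u)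
  have sC: "sqint C" unfolding C_def[abs_def] by (intro sqint_diff SS sqint_Sspan[OF k] u)
  have "l2int A \<le> card F * (\<Sum>m\<in>F. l2int (\<lambda>x. a m * (S (p m) x - Sspan k' fs' gs' (p m) x)))"
    unfolding A_def[abs_def] by (intro l2int_sum_le sqint_cmult sq' p)
  also have "\<dots> \<le> card F * (\<Sum>m\<in>F. (cmod (a m))\<^sup>2 * (\<eta>\<^sup>2 * V))"
  proof (intro mult_left_mono sum_mono)
    fix m assume m: "m \<in> F"
    have "l2int (\<lambda>x. S (p m) x - Sspan k' fs' gs' (p m) x) \<le> \<eta>\<^sup>2 * V"
      using le'[OF p(1)[OF m]] mult_left_mono[OF p(2)[OF m], of "\<eta>\<^sup>2"] by simp
    then show "l2int (\<lambda>x. a m * (S (p m) x - Sspan k' fs' gs' (p m) x)) \<le> (cmod (a m))\<^sup>2 * (\<eta>\<^sup>2 * V)"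
      unfolding l2int_cmult by (intro mult_left_mono) auto
  qed auto
  also have "\<dots> = (\<Sum>m\<in>F. (cmod (a m))\<^sup>2) * (\<eta>\<^sup>2 * card F * V)"
    by (simp add: sum_distrib_right mult_ac sum_distrib_left)
  also have "\<dots> \<le> 1 * (\<epsilon>\<^sup>2 * V)"
    using a \<eta>1 V0 by (intro mult_mono) auto
  finally have nA: "l2int A \<le> \<epsilon>\<^sup>2 * V" by simp
  have nB: "l2int B \<le> \<epsilon>\<^sup>2 * V"
  proof -
    have "l2int B \<le> \<eta>\<^sup>2 * l2int u"
      using le'[OF u] unfolding B_def[abs_def] by (subst l2int_diff_commute)
    also have "\<dots> \<le> \<epsilon>\<^sup>2 * V"
      using \<eta>2 V by (intro mult_mono) (auto simp: u_def)
    finally show ?thesis .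
  qed
  have nC: "l2int C \<le> \<epsilon>\<^sup>2 * V"
  proof -
    have "l2int C \<le> \<epsilon>\<^sup>2 * l2int u" unfolding C_def[abs_def] by (rule le[OF u])
    also have "\<dots> \<le> \<epsilon>\<^sup>2 * V" using V by (intro mult_left_mono) (auto simp: u_def)
    finally show ?thesis .
  qed
  have lin: "Sspan j f g u x = (\<Sum>m\<in>F. a m * Sspan j f g (p m) x)"
    if "\<forall>i<j. Linf0 (f i) \<and> Cc (g i)" for j f g x
    unfolding u_def by (rule Sspan_sum[OF that p(1)])
  have "(\<Sum>m\<in>F. a m * (S (p m) x - Sspan k fs gs (p m) x)) = A x + (B x + C x)" for x
    unfolding A_def B_def C_def lin[OF k'] lin[OF k]
    by (simp add: right_diff_distrib sum_subtractf)
  then have "l2int (\<lambda>x. \<Sum>m\<in>F. a m * (S (p m) x - Sspan k fs gs (p m) x)) = l2int (\<lambda>x. A x + (B x + C x))"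
    by simp
  also have "\<dots> \<le> 2 * l2int A + 2 * (2 * l2int B + 2 * l2int C)"
    by (rule order_trans[OF l2int_add_le[OF sA sqint_add[OF sB sC]]])
       (intro add_left_mono mult_left_mono l2int_add_le sB sC, simp)
  \<comment> \<open>The total is \<open>10 * \<epsilon>\<^sup>2 * V\<close>; rounding up to 16, a
    perfect square, gives a simple weight in the later pairing estimate.\<close>
  also have "\<dots> \<le> 2 * (\<epsilon>\<^sup>2 * V) + 2 * (2 * (\<epsilon>\<^sup>2 * V) + 2 * (\<epsilon>\<^sup>2 * V))"
    by (intro add_mono mult_left_mono nA nB nC) auto
  also have "\<dots> \<le> 16 * \<epsilon>\<^sup>2 * V"
    using V0 by simp
  finally show ?thesis .
qed

section \<open>Matrix forms as pairings of synthesised functions\<close>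

lemma section_l2_le:
  assumes M: "mnorm_le M K" and F: "finite F" and x: "(\<Sum>m\<in>F. (cmod (x m))\<^sup>2) \<le> 1"
  shows "l2_le (\<lambda>n. \<Sum>m\<in>F. x m * M n m) (K\<^sup>2)"
  unfolding l2_le_def
proof (intro allI impI)
  fix H :: "int set" assume H: "finite H"
  have "(\<Sum>n\<in>H. (cmod (\<Sum>m\<in>F. x m * M n m))\<^sup>2) \<le> K\<^sup>2 * (\<Sum>m\<in>F. (cmod (x m))\<^sup>2)"
    using section_bound[OF M F H, of x] by (simp add: mult.commute)
  also have "\<dots> \<le> K\<^sup>2" using x by (intro mult_left_le) auto
  finally show "(\<Sum>n\<in>H. (cmod (\<Sum>m\<in>F. x m * M n m))\<^sup>2) \<le> K\<^sup>2" .
qed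

lemma l2int_synth_le:
  assumes "t > 0" "l2_le c B"
  shows "l2int (synth t c) \<le> 2 * B"
  using l2sq_synth_le[OF assms] l2sq_eq_l2int[OF sqint_synth[OF assms]] l2_le_nonneg[OF assms(2)]
  by (simp add: ennreal_le_iff)

text \<open>The form is the pairing of \<open>v\<close> with a combination of the
  \<open>S (psi t m)\<close>. Passing to the approximant changes it by the pairing of
  \<open>v\<close> with \<open>w\<close>, whose norm \<open>l2int_approx_error_le\<close> controls.
  The bound depends on neither \<open>t\<close> nor \<open>F\<close>.\<close>

lemma mform_beta_approx:
  assumes S: "inA0 S" and \<epsilon>: "\<epsilon> > 0"
    and k: "\<forall>i<k. Linf0 (fs i) \<and> Cc (gs i)"
    and SS: "\<And>u. sqint u \<Longrightarrow> sqint (S u)"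
    and le: "\<And>u. sqint u \<Longrightarrow> l2int (\<lambda>x. S u x - Sspan k fs gs u x) \<le> \<epsilon>\<^sup>2 * l2int u"
    and C: "mnorm_le Cmat K" and t: "t > 0" and F: "finite F"
    and x: "(\<Sum>m\<in>F. (cmod (x m))\<^sup>2) \<le> 1" and y: "(\<Sum>m\<in>F. (cmod (y m))\<^sup>2) \<le> 1"
  shows "cmod (mform (beta t S) F x y
      - (\<Sum>i<k. LINT z|lborel. cnj (synth t (\<lambda>n. \<Sum>m\<in>F. y m * Cmat n m) z)
             * Sfg (fs i) (gs i) (synth t (\<lambda>n. \<Sum>m\<in>F. x m * Cmat n m)) z)) \<le> 8 * \<epsilon> * K\<^sup>2"
proof -
  let ?S' = "Sspan k fs gs"
  define u where "u = synth t (\<lambda>n. \<Sum>m\<in>F. x m * Cmat n m)"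
  define v where "v = synth t (\<lambda>n. \<Sum>m\<in>F. y m * Cmat n m)"
  have u_eq: "u = (\<lambda>z. \<Sum>m\<in>F. x m * psi t m z)" and v_eq: "v = (\<lambda>z. \<Sum>m\<in>F. y m * psi t m z)"
    unfolding u_def v_def psi_eq_synth by (intro ext synth_sum)+
  have lu: "l2_le (\<lambda>n. \<Sum>m\<in>F. x m * Cmat n m) (K\<^sup>2)" and lv: "l2_le (\<lambda>n. \<Sum>m\<in>F. y m * Cmat n m) (K\<^sup>2)"
    by (rule section_l2_le[OF C F x] section_l2_le[OF C F y])+
  have su: "sqint u" and sv: "sqint v"
    unfolding u_def v_def by (rule sqint_synth[OF t lu] sqint_synth[OF t lv])+
  have nu: "l2int u \<le> 2 * K\<^sup>2" and nv: "l2int v \<le> 2 * K\<^sup>2"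
    unfolding u_def v_def by (rule l2int_synth_le[OF t lu] l2int_synth_le[OF t lv])+
  have sp: "sqint (psi t m)" for m
    unfolding psi_eq_synth by (rule sqint_synth[OF t column_l2_le[OF C]])
  have np: "l2int (psi t m) \<le> 2 * K\<^sup>2" for m
    unfolding psi_eq_synth by (rule l2int_synth_le[OF t column_l2_le[OF C]])
  define w where "w z = (\<Sum>m\<in>F. x m * (S (psi t m) z - ?S' (psi t m) z))" for z
  have sw: "sqint w"
    unfolding w_def[abs_def] by (intro sqint_sum sqint_cmult sqint_diff SS sqint_Sspan[OF k] sp)
  have nw: "l2int w \<le> 16 * \<epsilon>\<^sup>2 * (2 * K\<^sup>2)"
    unfolding w_def[abs_def]
    by (rule l2int_approx_error_le[OF S \<epsilon> k le sp np x nu[unfolded u_eq]])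
  have i1: "integrable lborel (\<lambda>z. cnj (psi t n z) * S (psi t m) z)" for n m
    by (intro integrable_mult_sqint sqint_cnj SS sp)
  have "mform (beta t S) F x y = (\<Sum>n\<in>F. \<Sum>m\<in>F. LINT z|lborel. cnj (y n) * (cnj (psi t n z) * S (psi t m) z) * x m)"
    unfolding mform_def beta_def by simp
  also have "\<dots> = (LINT z|lborel. (\<Sum>n\<in>F. \<Sum>m\<in>F. cnj (y n) * (cnj (psi t n z) * S (psi t m) z) * x m))"
    using i1 by (simp add: Bochner_Integration.integral_sum)
  also have "\<dots> = (LINT z|lborel. cnj (v z) * (\<Sum>m\<in>F. x m * S (psi t m) z))"
    unfolding v_eq cnj_sum complex_cnj_mult sum_product by (simp only: mult_ac)
  finally have m: "mform (beta t S) F x y = (LINT z|lborel. cnj (v z) * (\<Sum>m\<in>F. x m * S (psi t m) z))" .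
  have i2: "integrable lborel (\<lambda>z. cnj (v z) * (\<Sum>m\<in>F. x m * S (psi t m) z))"
    by (intro integrable_mult_sqint sqint_cnj sv sqint_sum sqint_cmult SS sp)
  have i3: "integrable lborel (\<lambda>z. cnj (v z) * ?S' u z)"
    by (intro integrable_mult_sqint sqint_cnj sv sqint_Sspan[OF k] su)
  have "(\<Sum>i<k. LINT z|lborel. cnj (v z) * Sfg (fs i) (gs i) u z)
     = (LINT z|lborel. (\<Sum>i<k. cnj (v z) * Sfg (fs i) (gs i) u z))"
    using k by (intro Bochner_Integration.integral_sum[symmetric] integrable_mult_sqint sqint_cnj sv sqint_Sfg su) auto
  also have "\<dots> = (LINT z|lborel. cnj (v z) * ?S' u z)"
    by (simp add: Sspan_def sum_distrib_left)
  finally have "mform (beta t S) F x y - (\<Sum>i<k. LINT z|lborel. cnj (v z) * Sfg (fs i) (gs i) u z)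
     = (LINT z|lborel. cnj (v z) * (\<Sum>m\<in>F. x m * S (psi t m) z) - cnj (v z) * ?S' u z)"
    unfolding m by (simp only: Bochner_Integration.integral_diff[OF i2 i3])
  also have "\<dots> = (LINT z|lborel. cnj (v z) * w z)"
    unfolding w_def u_eq Sspan_sum[OF k sp] right_diff_distrib[symmetric] sum_subtractf[symmetric] ..
  \<comment> \<open>The weight \<open>4 * \<epsilon>\<close> balances the two terms: each is then at
    most \<open>8 * \<epsilon> * K\<^sup>2\<close>.\<close>
  also have "cmod \<dots> \<le> (4 * \<epsilon> * l2int v + l2int w / (4 * \<epsilon>)) / 2"
    using \<epsilon> by (intro cmod_pairing_le sv sw) simp
  also have "\<dots> \<le> (4 * \<epsilon> * (2 * K\<^sup>2) + 16 * \<epsilon>\<^sup>2 * (2 * K\<^sup>2) / (4 * \<epsilon>)) / 2"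
    using \<epsilon> nv nw by (intro divide_right_mono add_mono mult_left_mono) auto
  also have "\<dots> = 8 * \<epsilon> * K\<^sup>2"
    using \<epsilon> by (simp add: power2_eq_square field_simps)
  finally show ?thesis unfolding u_def v_def .
qed

theorem theorem1:
  assumes "inA0 S"
  shows "\<forall>t>0. \<forall>\<epsilon>>0. \<exists>\<delta>>0. \<forall>s>0. \<bar>s - t\<bar> < \<delta> \<longrightarrow>
           mnorm_le (\<lambda>n m. beta s S n m - beta t S n m) \<epsilon>"
proof (intro allI impI)
  fix t \<epsilon> :: real assume t: "t > 0" and \<epsilon>: "\<epsilon> > 0"
  obtain K where C: "mnorm_le Cmat K"
    using bounded_matrix_Cmat unfolding bounded_matrix_def by blast
  \<comment> \<open>Scaled so that the error of \<open>mform_beta_approx\<close> is at most a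
    quarter of \<open>\<epsilon>\<close>; \<open>K\<^sup>2 + 1\<close> avoids dividing by
    zero.\<close>
  define \<epsilon>' where "\<epsilon>' = \<epsilon> / (32 * (K\<^sup>2 + 1))"
  have K1: "K\<^sup>2 + 1 > 0" using zero_le_power2[of K] by linarith
  have \<epsilon>': "\<epsilon>' > 0" using \<epsilon> K1 by (simp add: \<epsilon>'_def)
  have "8 * \<epsilon>' * K\<^sup>2 \<le> 8 * \<epsilon>' * (K\<^sup>2 + 1)" using \<epsilon>' by simp
  also have "\<dots> = \<epsilon> / 4" using K1 by (simp add: \<epsilon>'_def field_simps)
  finally have small: "8 * \<epsilon>' * K\<^sup>2 \<le> \<epsilon> / 4" .
  obtain k fs gs where k: "\<forall>i<k. Linf0 (fs i) \<and> Cc (gs i)"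
    and SS: "\<And>u. sqint u \<Longrightarrow> sqint (S u)"
    and le: "\<And>u. sqint u \<Longrightarrow> l2int (\<lambda>x. S u x - Sspan k fs gs u x) \<le> \<epsilon>'\<^sup>2 * l2int u"
    using inA0_approx[OF assms \<epsilon>'] by metis
  define J where "J r c d i = (LINT z|lborel. cnj (synth r d z) * Sfg (fs i) (gs i) (synth r c) z)" for r c d i
  \<comment> \<open>This leaves \<open>\<epsilon> / 2\<close> in total for the \<open>k\<close>
    generators; \<open>k + 1\<close> covers the empty combination.\<close>
  define \<gamma> where "\<gamma> = \<epsilon> / (2 * (real k + 1))"
  have \<gamma>: "\<gamma> > 0" using \<epsilon> by (simp add: \<gamma>_def)
  \<comment> \<open>The approximant is fixed independently of \<open>s\<close>, and finitely many
    generators allow a common neighbourhood of \<open>t\<close>.\<close>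
  have "\<forall>\<^sub>F s in nhds t. \<forall>i\<in>{..<k}. \<forall>c d. l2_le c (K\<^sup>2) \<longrightarrow> l2_le d (K\<^sup>2) \<longrightarrow> cmod (J s c d i - J t c d i) < \<gamma>"
    unfolding J_def using k by (intro eventually_ball_finite ballI Sfg_form_continuous t \<gamma>) auto
  then obtain \<delta> where \<delta>: "\<delta> > 0" and close: "\<And>s i c d. \<bar>s - t\<bar> < \<delta> \<Longrightarrow> i < k \<Longrightarrow> l2_le c (K\<^sup>2) \<Longrightarrow> l2_le d (K\<^sup>2)
      \<Longrightarrow> cmod (J s c d i - J t c d i) < \<gamma>"
    unfolding eventually_nhds_metric dist_real_def by blast
  show "\<exists>\<delta>>0. \<forall>s>0. \<bar>s - t\<bar> < \<delta> \<longrightarrow> mnorm_le (\<lambda>n m. beta s S n m - beta t S n m) \<epsilon>"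
  proof (intro exI[of _ \<delta>] conjI allI impI \<delta>)
    fix s :: real assume s: "s > 0" "\<bar>s - t\<bar> < \<delta>"
    show "mnorm_le (\<lambda>n m. beta s S n m - beta t S n m) \<epsilon>"
      unfolding mnorm_le_def mform_diff
    proof (intro allI impI)
      fix F and x y :: "int \<Rightarrow> complex"
      assume F: "finite F" and x: "(\<Sum>m\<in>F. (cmod (x m))\<^sup>2) \<le> 1" and y: "(\<Sum>n\<in>F. (cmod (y n))\<^sup>2) \<le> 1"
      define c where "c = (\<lambda>n. \<Sum>m\<in>F. x m * Cmat n m)"
      define d where "d = (\<lambda>n. \<Sum>m\<in>F. y m * Cmat n m)"
      have approx: "cmod (mform (beta r S) F x y - (\<Sum>i<k. J r c d i)) \<le> \<epsilon> / 4" if "r > 0" for r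
        using mform_beta_approx[OF assms \<epsilon>' k SS le C that F x y] small
        unfolding J_def c_def d_def by linarith
      have "(\<Sum>i<k. J s c d i) - (\<Sum>i<k. J t c d i) = (\<Sum>i<k. J s c d i - J t c d i)"
        by (rule sum_subtractf[symmetric])
      also have "cmod \<dots> \<le> (\<Sum>i<k. \<gamma>)"
        using close[OF s(2)] section_l2_le[OF C F x] section_l2_le[OF C F y]
        unfolding c_def d_def by (intro sum_norm_le less_imp_le) auto
      also have "\<dots> \<le> (real k + 1) * \<gamma>" using \<gamma> by simp
      also have "\<dots> = \<epsilon> / 2" by (simp add: \<gamma>_def field_simps)
      finally have mid: "cmod ((\<Sum>i<k. J s c d i) - (\<Sum>i<k. J t c d i)) \<le> \<epsilon> / 2" .
      have tri3: "cmod (p - q) \<le> cmod (p - p') + cmod (p' - q') + cmod (q - q')" for p q p' q'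
        using order_trans[OF norm_triangle_ineq4[of "p - p' + (p' - q')" "q - q'"]
            add_right_mono[OF norm_triangle_ineq]] by simp
      \<comment> \<open>Each form is compared with the approximant at its own scale, and the two
        approximants with each other.\<close>
      have "cmod (mform (beta s S) F x y - mform (beta t S) F x y) \<le> \<epsilon> / 4 + \<epsilon> / 2 + \<epsilon> / 4"
        by (rule order_trans[OF tri3 add_mono[OF add_mono[OF approx[OF s(1)] mid] approx[OF t]]])
      then show "cmod (mform (beta s S) F x y - mform (beta t S) F x y) \<le> \<epsilon>" by simp
    qed
  qed
qed

end
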